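(* Let $N\ge 1$ and let $\mu\colon\mathcal{C}^N\to\mathbb{R}$ be a continuous and translation invariant valuation. Then, for every $k\in\{0,\dots,N\}$, there exists a continuous, translation invariant and $k$-homogeneous valuation $\mu_k\colon\mathcal{C}^N\to\mathbb{R}$ such that $$\mu=\sum_{k=0}^{N}\mu_k .$$ Moreover, the valuations $\mu_0,\dots,\mu_N$ are uniquely determined.
   Context: A convex body is a nonempty compact convex subset of $\mathbb{R}^N$. $\mathcal{C}^N$ is the set of all functions $f\colon\mathbb{R}^N\to[0,\infty)$ (called quasi-concave) such that for every $t>0$ the super-level set $L_t(f)=\{x\in\mathbb{R}^N: f(x)\ge t\}$ is either empty or a convex body. Write $f\vee g$ and $f\wedge g$ for the pointwise maximum and minimum; $f\wedge g\in\mathcal{C}^N$ whenever $f,g\in\mathcal{C}^N$. A valuation on $\mathcal{C}^N$ is a functional $\mu\colon\mathcal{C}^N\to\mathbb{R}$ with $\mu(\underline{0})=0$, where $\underline{0}$ is the identically zero function, and $\mu(f\vee g)+\mu(f\wedge g)=\mu(f)+\mu(g)$ for all $f,g\in\mathcal{C}^N$ such that $f\vee g\in\mathcal{C}^N$. It is continuous if $\mu(f_i)\to\mu(f)$ whenever $f\in\mathcal{C}^N$ and $(f_i)_{i\in\mathbb{N}}$ is a sequence in $\mathcal{C}^N$ which converges pointwise to $f$ on $\mathbb{R}^N$ and is either pointwise increasing or pointwise decreasing in $i$ (in the weak sense). It is translation invariant if $\mu(f\circ T)=\mu(f)$ for every $f\in\mathcal{C}^N$ and every translation $T$ of $\mathbb{R}^N$.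 It is $k$-homogeneous if $\mu(f_\lambda)=\lambda^k\mu(f)$ for all $f\in\mathcal{C}^N$ and $\lambda>0$, where $f_\lambda(x)=f(x/\lambda)$. *)

theory Defs
  imports "HOL-Analysis.Analysis"
begin

definition convex_body :: "(real ^ 'n) set \<Rightarrow> bool" where
  "convex_body K \<longleftrightarrow> K \<noteq> {} \<and> compact K \<and> convex K"

definition superlevel :: "real \<Rightarrow> (real ^ 'n \<Rightarrow> real) \<Rightarrow> (real ^ 'n) set" where
  "superlevel t f = {x. f x \<ge> t}"

definition quasi_concave :: "(real ^ 'n \<Rightarrow> real) set" where
  "quasi_concave = {f. (\<forall>x. f x \<ge> 0) \<and>
     (\<forall>t>0. superlevel t f = {} \<or> convex_body (superlevel t f))}"

text \<open>A functional on the quasi-concave functions is represented by a total HOL function on all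
  real-valued functions. The predicates below constrain only its values on \<^term>\<open>quasi_concave\<close>,
  so equality of functionals means agreement on that set.\<close>

definition valuation :: "((real ^ 'n \<Rightarrow> real) \<Rightarrow> real) \<Rightarrow> bool" where
  "valuation \<mu> \<longleftrightarrow> \<mu> (\<lambda>x. 0) = 0 \<and>
     (\<forall>f\<in>quasi_concave. \<forall>g\<in>quasi_concave. (\<lambda>x. max (f x) (g x)) \<in> quasi_concave \<longrightarrow>
        \<mu> (\<lambda>x. max (f x) (g x)) + \<mu> (\<lambda>x. min (f x) (g x)) = \<mu> f + \<mu> g)"

definition continuous_val :: "((real ^ 'n \<Rightarrow> real) \<Rightarrow> real) \<Rightarrow> bool" where
  "continuous_val \<mu> \<longleftrightarrow>
     (\<forall>f\<in>quasi_concave. \<forall>F :: nat \<Rightarrow> real ^ 'n \<Rightarrow> real.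
        (\<forall>i. F i \<in> quasi_concave) \<longrightarrow>
        (\<forall>x. (\<lambda>i. F i x) \<longlonglongrightarrow> f x) \<longrightarrow>
        (\<forall>x. incseq (\<lambda>i. F i x)) \<or> (\<forall>x. decseq (\<lambda>i. F i x)) \<longrightarrow>
        (\<lambda>i. \<mu> (F i)) \<longlonglongrightarrow> \<mu> f)"

definition translation_invariant :: "((real ^ 'n \<Rightarrow> real) \<Rightarrow> real) \<Rightarrow> bool" where
  "translation_invariant \<mu> \<longleftrightarrow> (\<forall>f\<in>quasi_concave. \<forall>a. \<mu> (f \<circ> (\<lambda>x. x + a)) = \<mu> f)"

definition homogeneous :: "nat \<Rightarrow> ((real ^ 'n \<Rightarrow> real) \<Rightarrow> real) \<Rightarrow> bool" where
  "homogeneous k \<mu> \<longleftrightarrow>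
     (\<forall>f\<in>quasi_concave. \<forall>c::real. c > 0 \<longrightarrow> \<mu> (\<lambda>x. f (x /\<^sub>R c)) = c ^ k * \<mu> f)"

definition homogeneous_decomposition ::
  "((real ^ 'n \<Rightarrow> real) \<Rightarrow> real) \<Rightarrow> (nat \<Rightarrow> (real ^ 'n \<Rightarrow> real) \<Rightarrow> real) \<Rightarrow> bool" where
  "homogeneous_decomposition \<mu> \<nu> \<longleftrightarrow>
     (\<forall>k\<le>CARD('n). valuation (\<nu> k) \<and> continuous_val (\<nu> k) \<and>
        translation_invariant (\<nu> k) \<and> homogeneous k (\<nu> k)) \<and>
     (\<forall>f\<in>quasi_concave. \<mu> f = (\<Sum>k=0..CARD('n). \<nu> k f))"

end

theory Submission
  imports Defs
begin

text \<open>Interpolating at the dilations by 1, \<dots>, N + 1, the decomposition is equivalent to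
  \<open>\<mu> f\<^sub>c = \<Sum>\<^sub>j \<ell>\<^sub>j(c) \<mu> f\<^sub>j\<close> for all \<open>c > 0\<close>, where the \<open>\<ell>\<^sub>j\<close> are the Lagrange
  polynomials; the components are then read off from the coefficients of the \<open>\<ell>\<^sub>j\<close>. This identity is linear
  and stable under limits. The valuation property reduces step functions to multiples of indicators, and every
  quasi-concave function is an increasing limit of step functions, so it suffices to treat a valuation
  \<open>\<phi>\<close> on convex bodies that is continuous along decreasing sequences.

  For the convex hull \<open>C\<close> of \<open>{0} \<union> D\<close>, the body \<open>L + (n + 1) C\<close> is the union of
  \<open>L + n C\<close> and \<open>(L + C) + n D\<close>, which meet in \<open>L + n D\<close>. Induction on the number of vertices thus
  makes \<open>\<phi> (L + n P)\<close> a polynomial in \<open>n\<close> for every polytope \<open>P\<close>. Its degree is at most \<open>N\<close>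
  for a polytope with integral halfspaces: the unit grid cuts \<open>n P\<close> into \<open>O(n\<^sup>N)\<close> pieces of finitely many
  shapes. Finally, every convex body is a decreasing limit of dyadic multiples of such polytopes.\<close>

section \<open>Polynomial sequences and Lagrange interpolation\<close>

text \<open>Strong induction on \<open>k\<close>: the difference of \<open>x ^ Suc k\<close> is
  \<open>Suc k * x ^ k\<close> plus lower powers of \<open>x\<close>. The antidifferences of these
  lower powers are collected in \<open>Q\<close> and subtracted.\<close>

lemma monom_antidifference:
  "\<exists>p :: real poly. \<forall>x. poly p (x + 1) - poly p x = x ^ k"
proof (induction k rule: less_induct)
  case (less k)
  then obtain P :: "nat \<Rightarrow> real poly"
    where P: "\<And>i x. i < k \<Longrightarrow> poly (P i) (x + 1) - poly (P i) x = x ^ i"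
    by metis
  define Q where "Q = (\<Sum>i<k. smult (real (Suc k choose i)) (P i))"
  define p where "p = smult (1 / real (Suc k)) (monom 1 (Suc k) - Q)"
  have "poly p (x + 1) - poly p x = x ^ k" for x
  proof -
    have "(x + 1) ^ Suc k = (\<Sum>i\<le>Suc k. real (Suc k choose i) * x ^ i)"
      using binomial_ring[of x 1 "Suc k"] by simp
    also have "\<dots> = (\<Sum>i<k. real (Suc k choose i) * x ^ i) + real (Suc k) * x ^ k + x ^ Suc k"
      by (simp add: lessThan_Suc_atMost[symmetric] del: binomial_Suc_Suc)
    also have "(\<Sum>i<k. real (Suc k choose i) * x ^ i) = poly Q (x + 1) - poly Q x"
      unfolding Q_def poly_sum poly_smult sum_subtractf[symmetric] right_diff_distrib[symmetric]
      by (intro sum.cong) (simp_all add: P)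
    finally have "(x + 1) ^ Suc k - x ^ Suc k - (poly Q (x + 1) - poly Q x) = real (Suc k) * x ^ k"
      by simp
    moreover have "poly p (x + 1) - poly p x
        = ((x + 1) ^ Suc k - x ^ Suc k - (poly Q (x + 1) - poly Q x)) / real (Suc k)"
      unfolding p_def poly_smult poly_diff poly_monom by (simp add: diff_divide_distrib)
    ultimately show ?thesis
      by simp
  qed
  then show ?case
    by blast
qed

lemma poly_antidifference:
  "\<exists>p :: real poly. \<forall>x. poly p (x + 1) - poly p x = poly q x"
proof -
  obtain P :: "nat \<Rightarrow> real poly" where P: "\<And>i x. poly (P i) (x + 1) - poly (P i) x = x ^ i"
    using monom_antidifference by metis
  have "poly (\<Sum>i\<le>degree q. smult (coeff q i) (P i)) (x + 1)
      - poly (\<Sum>i\<le>degree q. smult (coeff q i) (P i)) x = poly q x" for x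
    unfolding poly_sum poly_smult sum_subtractf[symmetric] right_diff_distrib[symmetric] P
    by (simp add: poly_altdef)
  then show ?thesis
    by blast
qed

text \<open>\<open>g\<close> and an antidifference of \<open>q\<close> have the same increments on
  the natural numbers, so they differ by their constant gap at 0.\<close>

lemma polynomial_sequence_if_difference:
  fixes g :: "nat \<Rightarrow> real"
  assumes "\<And>n. g (Suc n) - g n = poly q (real n)"
  shows "\<exists>p. \<forall>n. g n = poly p (real n)"
proof -
  obtain p :: "real poly" where p: "\<And>x. poly p (x + 1) - poly p x = poly q x"
    using poly_antidifference by blast
  have "g n = poly (p + [:g 0 - poly p 0:]) (real n)" for n
  proof (induction n)
    case (Suc n)
    then show ?case
      using assms[of n] p[of "real n"] by (simp add: add.commute)
  qed simp
  then show ?thesis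
    by blast
qed

text \<open>If the degree exceeded \<open>N\<close>, subtracting the bound would not change the
  leading term. The difference would then eventually be at least the positive leading coefficient,
  although it is nonpositive at every natural \<open>n \<ge> 1\<close>.\<close>

lemma degree_le_if_lead_coeff_pos_le:
  fixes p :: "real poly"
  assumes "\<And>n. n \<ge> 1 \<Longrightarrow> poly p (real n) \<le> B * (real n + 1) ^ N" and "lead_coeff p > 0"
  shows "degree p \<le> N"
proof (rule ccontr)
  assume "\<not> degree p \<le> N"
  define q where "q = smult B ([:1, 1:] ^ N)"
  have "degree q \<le> degree ([:1, 1:] ^ N :: real poly)"
    unfolding q_def by simp
  also have "\<dots> \<le> N"
    by (simp add: degree_linear_power)
  finally have "degree q < degree p"
    using \<open>\<not> degree p \<le> N\<close> by simp
  then have "lead_coeff (p - q) = lead_coeff p"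
    by (metis coeff_diff coeff_eq_0 degree_add_eq_left degree_minus diff_zero uminus_add_conv_diff add.commute)
  then obtain X where X: "\<And>x. x \<ge> X \<Longrightarrow> lead_coeff p \<le> poly (p - q) x"
    using poly_pinfty_gt_lc[of "p - q"] assms(2) by auto
  obtain n where n: "real n \<ge> max X 1"
    using real_arch_simple by blast
  then have "lead_coeff p \<le> poly p (real n) - B * (real n + 1) ^ N"
    using X[of "real n"] by (simp add: q_def add.commute)
  then show False
    using assms(1)[of n] assms(2) n by simp
qed

lemma degree_le_if_growth:
  fixes p :: "real poly"
  assumes "\<And>n. n \<ge> 1 \<Longrightarrow> \<bar>poly p (real n)\<bar> \<le> B * (real n + 1) ^ N"
  shows "degree p \<le> N"
proof -
  have "lead_coeff p > 0 \<or> lead_coeff (- p) > 0 \<or> p = 0"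
    by (metis degree_minus coeff_minus leading_coeff_0_iff neg_0_less_iff_less linorder_neqE_linordered_idom)
  then show ?thesis
    using degree_le_if_lead_coeff_pos_le[of p B N] degree_le_if_lead_coeff_pos_le[of "- p" B N]
      assms by (auto simp: abs_le_iff)
qed

text \<open>The interpolation nodes are 1, ..., N + 1. They start at 1 because they later serve as
  dilation factors, which must be positive.\<close>

definition lagrange :: "nat \<Rightarrow> nat \<Rightarrow> real poly" where
  "lagrange N j = (\<Prod>i\<in>{1..Suc N} - {j}. smult (1 / (real j - real i)) [:- real i, 1:])"

lemma degree_lagrange:
  assumes "j \<in> {1..Suc N}"
  shows "degree (lagrange N j) \<le> N"
proof -
  have "degree (lagrange N j) \<le>
      sum (degree \<circ> (\<lambda>i. smult (1 / (real j - real i)) [:- real i, 1:])) ({1..Suc N} - {j})"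
    unfolding lagrange_def by (intro degree_prod_sum_le) simp
  also have "\<dots> \<le> sum (\<lambda>i. 1) ({1..Suc N} - {j})"
    by (intro sum_mono) simp
  finally show ?thesis
    using assms by simp
qed

lemma poly_lagrange:
  assumes "j \<in> {1..Suc N}" and "i \<in> {1..Suc N}"
  shows "poly (lagrange N j) (real i) = (if i = j then 1 else 0)"
  using assms by (auto simp: lagrange_def poly_prod diff_divide_distrib[symmetric] intro!: prod.neutral)

text \<open>The difference of the two sides has degree at most \<open>N\<close> and vanishes at
  \<open>N + 1\<close> nodes.\<close>

lemma lagrange_interpolation:
  assumes "degree p \<le> N"
  shows "poly p x = (\<Sum>j=1..Suc N. poly (lagrange N j) x * poly p (real j))"
proof -
  define q where "q = p - (\<Sum>j=1..Suc N. smult (poly p (real j)) (lagrange N j))"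
  have "degree q \<le> N"
    unfolding q_def using assms degree_lagrange
    by (intro degree_diff_le degree_sum_le)
      (auto intro: order_trans[OF degree_smult_le] simp del: sum.cl_ivl_Suc)
  moreover have root: "poly q (real i) = 0" if "i \<in> {1..Suc N}" for i
  proof -
    have "(\<Sum>j=1..Suc N. poly p (real j) * poly (lagrange N j) (real i))
        = (\<Sum>j=1..Suc N. if j = i then poly p (real j) else 0)"
      using that by (intro sum.cong) (auto simp: poly_lagrange)
    then show ?thesis
      using that unfolding q_def by (simp add: poly_sum del: sum.cl_ivl_Suc)
  qed
  ultimately have "q = 0"
  proof (intro ccontr[of "q = 0"])
    assume "degree q \<le> N" "q \<noteq> 0"
    then have "card (real ` {1..Suc N}) \<le> card {x. poly q x = 0}"
      using root by (intro card_mono poly_roots_finite) auto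
    also have "\<dots> \<le> N"
      using card_poly_roots_bound[OF \<open>q \<noteq> 0\<close>] \<open>degree q \<le> N\<close> by simp
    finally show False
      by (simp add: card_image inj_on_def)
  qed
  then have "poly p x = poly (\<Sum>j=1..Suc N. smult (poly p (real j)) (lagrange N j)) x"
    unfolding q_def by simp
  then show ?thesis
    by (simp add: poly_sum mult.commute del: sum.cl_ivl_Suc)
qed

text \<open>The difference is a polynomial with infinitely many roots. This yields both the
  homogeneity of the components and their uniqueness.\<close>

lemma power_sum_coeffs_unique:
  fixes a b :: "nat \<Rightarrow> real"
  assumes "\<And>x. x > 0 \<Longrightarrow> (\<Sum>k=0..N. x ^ k * a k) = (\<Sum>k=0..N. x ^ k * b k)" and "k \<le> N"
  shows "a k = b k"
proof -
  define p where "p = (\<Sum>k=0..N. monom (a k - b k) k)"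
  have "poly p x = 0" if "x > 0" for x
    using assms(1)[OF that]
    by (simp add: p_def poly_sum poly_monom sum_subtractf algebra_simps)
  then have "\<not> finite {x. poly p x = 0}"
    using finite_subset[of "{0<..}" "{x. poly p x = 0}"] infinite_Ioi[of "0::real"] by auto
  then have "p = 0"
    using poly_roots_finite by blast
  then have "coeff p k = 0"
    by simp
  then show ?thesis
    using assms(2) by (simp add: p_def coeff_sum if_distrib sum.delta cong: if_cong)
qed

section \<open>Polynomiality on dilates of a polytope\<close>

lemma convex_add_scaled_mem:
  assumes "convex D" "d \<in> D" "e \<in> D" "a \<ge> 0" "b \<ge> 0"
  shows "\<exists>c\<in>D. a *\<^sub>R d + b *\<^sub>R e = (a + b) *\<^sub>R c"
proof (cases "a + b = 0")
  case True
  then show ?thesis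
    using assms by (intro bexI[of _ d]) (auto simp: add_nonneg_eq_0_iff)
next
  case False
  then have "(a / (a + b)) *\<^sub>R d + (b / (a + b)) *\<^sub>R e \<in> D"
    using assms by (intro convexD) (auto simp: add_divide_distrib[symmetric])
  moreover have "(a + b) *\<^sub>R ((a / (a + b)) *\<^sub>R d + (b / (a + b)) *\<^sub>R e) = a *\<^sub>R d + b *\<^sub>R e"
    using False by (simp add: scaleR_add_right)
  ultimately show ?thesis
    by metis
qed

text \<open>Radial coordinates: a point of the cone is a point of \<open>D\<close> scaled by some
  \<open>r\<close>. This and the next three lemmas reduce set identities for sums of cones to
  statements about \<open>r\<close>.\<close>

lemma mem_scaled_cone:
  fixes D :: "'a::real_vector set"
  assumes "convex D" "D \<noteq> {}" "t \<ge> 0"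
  shows "x \<in> (*\<^sub>R) t ` (convex hull insert 0 D) \<longleftrightarrow> (\<exists>r d. 0 \<le> r \<and> r \<le> t \<and> d \<in> D \<and> x = r *\<^sub>R d)"
proof
  assume "x \<in> (*\<^sub>R) t ` (convex hull insert 0 D)"
  then obtain y where "y \<in> convex hull insert 0 D" "x = t *\<^sub>R y"
    by blast
  moreover then obtain u d where "0 \<le> u" "u \<le> 1" "d \<in> D" "y = u *\<^sub>R d"
    using assms(1,2) by (auto simp: convex_hull_insert_alt hull_same)
  ultimately show "\<exists>r d. 0 \<le> r \<and> r \<le> t \<and> d \<in> D \<and> x = r *\<^sub>R d"
    using assms(3) by (intro exI[of _ "t * u"] exI[of _ d]) (auto simp: mult_left_le)
next
  assume "\<exists>r d. 0 \<le> r \<and> r \<le> t \<and> d \<in> D \<and> x = r *\<^sub>R d"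
  then obtain r d where r: "0 \<le> r" "r \<le> t" "d \<in> D" "x = r *\<^sub>R d"
    by blast
  \<comment> \<open>For \<open>t = 0\<close> the quotient is 0 by convention; then
    \<open>r = 0\<close> as well, and the argument still goes through.\<close>
  have "(r / t) *\<^sub>R d \<in> convex hull insert 0 D"
    using assms r
    by (auto simp: convex_hull_insert_alt hull_same divide_le_eq intro!: exI[of _ "r / t"] exI[of _ d])
  moreover have "x = t *\<^sub>R ((r / t) *\<^sub>R d)"
    using r by auto
  ultimately show "x \<in> (*\<^sub>R) t ` (convex hull insert 0 D)"
    by blast
qed

lemma mem_cone:
  fixes D :: "'a::real_vector set"
  assumes "convex D" "D \<noteq> {}"
  shows "x \<in> convex hull insert 0 D \<longleftrightarrow> (\<exists>r d. 0 \<le> r \<and> r \<le> 1 \<and> d \<in> D \<and> x = r *\<^sub>R d)"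
  using mem_scaled_cone[OF assms, of 1 x] by simp

lemma mem_plus_scaled_cone:
  fixes D L :: "'a::real_vector set"
  assumes "convex D" "D \<noteq> {}" "t \<ge> 0"
  shows "x \<in> L + (*\<^sub>R) t ` (convex hull insert 0 D) \<longleftrightarrow>
    (\<exists>l r d. l \<in> L \<and> 0 \<le> r \<and> r \<le> t \<and> d \<in> D \<and> x = l + r *\<^sub>R d)"
proof
  assume "x \<in> L + (*\<^sub>R) t ` (convex hull insert 0 D)"
  then obtain l y where "l \<in> L" "y \<in> (*\<^sub>R) t ` (convex hull insert 0 D)" "x = l + y"
    by (elim set_plus_elim)
  then show "\<exists>l r d. l \<in> L \<and> 0 \<le> r \<and> r \<le> t \<and> d \<in> D \<and> x = l + r *\<^sub>R d"
    unfolding mem_scaled_cone[OF assms] by blast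
next
  assume "\<exists>l r d. l \<in> L \<and> 0 \<le> r \<and> r \<le> t \<and> d \<in> D \<and> x = l + r *\<^sub>R d"
  then obtain l r d where "l \<in> L" "0 \<le> r" "r \<le> t" "d \<in> D" "x = l + r *\<^sub>R d"
    by blast
  moreover from this have "r *\<^sub>R d \<in> (*\<^sub>R) t ` (convex hull insert 0 D)"
    unfolding mem_scaled_cone[OF assms] by blast
  ultimately show "x \<in> L + (*\<^sub>R) t ` (convex hull insert 0 D)"
    by (simp add: set_plus_intro)
qed

lemma mem_plus_cone_plus_scaled:
  fixes D L :: "'a::real_vector set"
  assumes "convex D" "D \<noteq> {}"
  shows "x \<in> L + convex hull insert 0 D + (*\<^sub>R) t ` D \<longleftrightarrow>
    (\<exists>l s d e. l \<in> L \<and> 0 \<le> s \<and> s \<le> 1 \<and> d \<in> D \<and> e \<in> D \<and> x = l + s *\<^sub>R d + t *\<^sub>R e)"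
proof
  assume "x \<in> L + convex hull insert 0 D + (*\<^sub>R) t ` D"
  then obtain l y e where "l \<in> L" "y \<in> convex hull insert 0 D" "e \<in> D" "x = l + y + t *\<^sub>R e"
    by (elim set_plus_elim) blast
  then show "\<exists>l s d e. l \<in> L \<and> 0 \<le> s \<and> s \<le> 1 \<and> d \<in> D \<and> e \<in> D \<and> x = l + s *\<^sub>R d + t *\<^sub>R e"
    unfolding mem_cone[OF assms] by blast
next
  assume "\<exists>l s d e. l \<in> L \<and> 0 \<le> s \<and> s \<le> 1 \<and> d \<in> D \<and> e \<in> D \<and> x = l + s *\<^sub>R d + t *\<^sub>R e"
  then obtain l s d e where "l \<in> L" "0 \<le> s" "s \<le> 1" "d \<in> D" "e \<in> D" "x = l + s *\<^sub>R d + t *\<^sub>R e"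
    by blast
  moreover from this have "s *\<^sub>R d \<in> convex hull insert 0 D"
    unfolding mem_cone[OF assms] by blast
  ultimately show "x \<in> L + convex hull insert 0 D + (*\<^sub>R) t ` D"
    by (metis imageI set_plus_intro)
qed

text \<open>A point with radial coordinate \<open>r \<le> t\<close> lies in the first set; for
  \<open>r > t\<close> the splitting \<open>r = (r - t) + t\<close> puts it in the second.
  Conversely, convexity of \<open>D\<close> merges \<open>s *\<^sub>R d + t *\<^sub>R e\<close> into
  one point with radial coordinate \<open>s + t \<le> t + 1\<close>.\<close>

lemma scaled_cone_union:
  fixes D L :: "'a::real_vector set"
  assumes "convex D" "D \<noteq> {}" "t \<ge> 0"
  defines "C \<equiv> convex hull insert 0 D"
  shows "L + (*\<^sub>R) (t + 1) ` C = (L + (*\<^sub>R) t ` C) \<union> (L + C + (*\<^sub>R) t ` D)"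
proof (intro set_eqI iffI)
  fix x assume "x \<in> L + (*\<^sub>R) (t + 1) ` C"
  then obtain l r d where l: "l \<in> L" "0 \<le> r" "r \<le> t + 1" "d \<in> D" "x = l + r *\<^sub>R d"
    using mem_plus_scaled_cone[OF assms(1,2), of "t + 1" x L] assms(3)
    unfolding C_def by auto
  show "x \<in> (L + (*\<^sub>R) t ` C) \<union> (L + C + (*\<^sub>R) t ` D)"
  proof (cases "r \<le> t")
    case True
    then have "r *\<^sub>R d \<in> (*\<^sub>R) t ` C"
      using l mem_scaled_cone[OF assms(1-3)] unfolding C_def by blast
    then show ?thesis
      using l by (auto intro: set_plus_intro)
  next
    case False
    then have "(r - t) *\<^sub>R d \<in> C"
      using l False mem_cone[OF assms(1,2), of "(r - t) *\<^sub>R d"] unfolding C_def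
      by (metis diff_ge_0_iff_ge diff_le_eq add.commute linear)
    moreover have "x = l + (r - t) *\<^sub>R d + t *\<^sub>R d"
      by (simp add: l algebra_simps)
    ultimately show ?thesis
      using l by (metis UnI2 imageI set_plus_intro)
  qed
next
  fix x assume "x \<in> (L + (*\<^sub>R) t ` C) \<union> (L + C + (*\<^sub>R) t ` D)"
  then have "x \<in> L + (*\<^sub>R) t ` C \<or> x \<in> L + C + (*\<^sub>R) t ` D"
    by blast
  then consider (inner) l r d where "l \<in> L" "0 \<le> r" "r \<le> t" "d \<in> D" "x = l + r *\<^sub>R d"
    | (outer) l s d e where "l \<in> L" "0 \<le> s" "s \<le> 1" "d \<in> D" "e \<in> D" "x = l + s *\<^sub>R d + t *\<^sub>R e"
    unfolding C_def mem_plus_scaled_cone[OF assms(1-3)] mem_plus_cone_plus_scaled[OF assms(1,2)]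
    by blast
  then show "x \<in> L + (*\<^sub>R) (t + 1) ` C"
  proof cases
    case inner
    then have "r *\<^sub>R d \<in> (*\<^sub>R) (t + 1) ` C"
      using mem_scaled_cone[OF assms(1,2), of "t + 1"] assms(3) unfolding C_def by force
    then show ?thesis
      using inner by (auto intro: set_plus_intro)
  next
    case outer
    then obtain c where "c \<in> D" "s *\<^sub>R d + t *\<^sub>R e = (s + t) *\<^sub>R c"
      using convex_add_scaled_mem[OF assms(1)] assms(3) by metis
    then have "s *\<^sub>R d + t *\<^sub>R e \<in> (*\<^sub>R) (t + 1) ` C"
      using mem_scaled_cone[OF assms(1,2), of "t + 1"] assms(3) outer unfolding C_def
      by (metis add.commute add_left_mono add_nonneg_nonneg zero_le_one)
    then show ?thesis
      using outer by (auto simp: add.assoc intro: set_plus_intro)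
  qed
qed

lemma scaled_cone_Int:
  fixes D L :: "'a::real_vector set"
  assumes "convex D" "D \<noteq> {}" "t \<ge> 0" "convex L"
  defines "C \<equiv> convex hull insert 0 D"
  shows "(L + (*\<^sub>R) t ` C) \<inter> (L + C + (*\<^sub>R) t ` D) = L + (*\<^sub>R) t ` D"
proof (intro set_eqI iffI)
  fix x assume "x \<in> (L + (*\<^sub>R) t ` C) \<inter> (L + C + (*\<^sub>R) t ` D)"
  then obtain l r d l' s e e' where 1: "l \<in> L" "0 \<le> r" "r \<le> t" "d \<in> D" "x = l + r *\<^sub>R d"
    and 2: "l' \<in> L" "0 \<le> s" "s \<le> 1" "e \<in> D" "e' \<in> D" "x = l' + s *\<^sub>R e + t *\<^sub>R e'"
    using mem_plus_scaled_cone[OF assms(1-3), of x L] mem_plus_cone_plus_scaled[OF assms(1,2), of x L t]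
    unfolding C_def by auto
  obtain c where c: "c \<in> D" "s *\<^sub>R e + t *\<^sub>R e' = (s + t) *\<^sub>R c"
    using convex_add_scaled_mem[OF assms(1)] assms(3) 2 by metis
  have x2: "x = l' + (s + t) *\<^sub>R c"
    using 2(6) c(2) by (simp add: add.assoc)
  show "x \<in> L + (*\<^sub>R) t ` D"
  proof (cases "r = t")
    case True
    then show ?thesis
      using 1 by (auto intro: set_plus_intro)
  next
    case False
    \<comment> \<open>On the segment from the first representation to the second, which is constantly x in the
      ambient space, the radial coordinate passes from r to s + t and hence through t.\<close>
    define \<beta> where "\<beta> = (t - r) / (s + t - r)"
    define \<alpha> where "\<alpha> = s / (s + t - r)"
    have pos: "s + t - r > 0"
      using False 1 2 by simp
    have ab: "\<alpha> \<ge> 0" "\<beta> \<ge> 0" "\<alpha> + \<beta> = 1"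
      using pos 1 2 unfolding \<alpha>_def \<beta>_def by (auto simp: add_divide_distrib[symmetric])
    have rad: "\<alpha> * r + \<beta> * (s + t) = t"
    proof -
      have "\<alpha> * r + \<beta> * (s + t) = (s * r + (t - r) * (s + t)) / (s + t - r)"
        unfolding \<alpha>_def \<beta>_def by (simp add: add_divide_distrib)
      also have "s * r + (t - r) * (s + t) = t * (s + t - r)"
        by (simp add: algebra_simps)
      finally show ?thesis
        using pos by simp
    qed
    obtain c' where c': "c' \<in> D" "(\<alpha> * r) *\<^sub>R d + (\<beta> * (s + t)) *\<^sub>R c = t *\<^sub>R c'"
      using convex_add_scaled_mem[OF assms(1) 1(4) c(1), of "\<alpha> * r" "\<beta> * (s + t)"] ab 1 2 assms(3) rad
      by auto
    have "x = \<alpha> *\<^sub>R x + \<beta> *\<^sub>R x"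
      using ab by (metis scaleR_left_distrib scaleR_one)
    also have "\<dots> = \<alpha> *\<^sub>R (l + r *\<^sub>R d) + \<beta> *\<^sub>R (l' + (s + t) *\<^sub>R c)"
      using 1(5) x2 by metis
    also have "\<dots> = (\<alpha> *\<^sub>R l + \<beta> *\<^sub>R l') + ((\<alpha> * r) *\<^sub>R d + (\<beta> * (s + t)) *\<^sub>R c)"
      by (simp add: scaleR_add_right)
    also have "\<dots> \<in> L + (*\<^sub>R) t ` D"
      using ab 1 2 c' assms(4) by (auto intro!: set_plus_intro convexD)
    finally show ?thesis .
  qed
next
  fix x assume "x \<in> L + (*\<^sub>R) t ` D"
  then obtain l d where l: "l \<in> L" "d \<in> D" "x = l + t *\<^sub>R d"
    unfolding set_plus_def by auto
  have "t *\<^sub>R d \<in> (*\<^sub>R) t ` C"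
    using l mem_scaled_cone[OF assms(1-3)] assms(3) unfolding C_def by blast
  moreover have "0 \<in> C"
    unfolding C_def by (simp add: hull_inc)
  then have "l + 0 \<in> L + C"
    using l by (intro set_plus_intro)
  ultimately show "x \<in> (L + (*\<^sub>R) t ` C) \<inter> (L + C + (*\<^sub>R) t ` D)"
    using l by (auto intro: set_plus_intro)
qed

section \<open>Translation invariant valuations on convex bodies\<close>

lemma scaled_translation:
  "(*\<^sub>R) c ` ({v} + S) = {c *\<^sub>R v} + (*\<^sub>R) c ` S" for v :: "'a::real_vector"
  by (force simp: set_plus_def scaleR_add_right image_iff)

lemma compact_set_plus:
  fixes S T :: "'a::real_normed_vector set"
  assumes "compact S" "compact T"
  shows "compact (S + T)"
proof -
  have "S + T = {x + y |x y. x \<in> S \<and> y \<in> T}"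
    by (auto simp: set_plus_def)
  then show ?thesis
    using compact_sums[OF assms] by simp
qed

locale translation_invariant_body_valuation =
  fixes \<phi> :: "(real ^ 'n) set \<Rightarrow> real"
  assumes empty: "\<phi> {} = 0"
    and union: "\<lbrakk>compact K; convex K; compact L; convex L; convex (K \<union> L)\<rbrakk>
      \<Longrightarrow> \<phi> (K \<union> L) + \<phi> (K \<inter> L) = \<phi> K + \<phi> L"
    and translate: "\<lbrakk>compact K; convex K\<rbrakk> \<Longrightarrow> \<phi> ((+) a ` K) = \<phi> K"
begin

text \<open>The valuation property turns the union and intersection formulas into a difference
  equation: one more copy of the cone \<open>C\<close> is accounted for by dilates of its base
  \<open>D\<close> alone.\<close>

lemma cone_difference:
  assumes "compact L" "convex L" "compact D" "convex D" "D \<noteq> {}"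
  defines "C \<equiv> convex hull insert 0 D"
  shows "\<phi> (L + (*\<^sub>R) (real (Suc n)) ` C) - \<phi> (L + (*\<^sub>R) (real n) ` C) =
    \<phi> (L + C + (*\<^sub>R) (real n) ` D) - \<phi> (L + (*\<^sub>R) (real n) ` D)"
proof -
  have C: "compact C" "convex C"
    unfolding C_def using assms by (auto intro: compact_convex_hull)
  have eq: "L + (*\<^sub>R) (real (Suc n)) ` C = (L + (*\<^sub>R) (real n) ` C) \<union> (L + C + (*\<^sub>R) (real n) ` D)"
    using scaled_cone_union[OF assms(4,5), of "real n" L] unfolding C_def by (simp add: add.commute)
  have "convex (L + (*\<^sub>R) (real (Suc n)) ` C)"
    using C assms by (auto intro!: convex_set_plus convex_scaling)
  then have "\<phi> (L + (*\<^sub>R) (real (Suc n)) ` C)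
      + \<phi> ((L + (*\<^sub>R) (real n) ` C) \<inter> (L + C + (*\<^sub>R) (real n) ` D))
      = \<phi> (L + (*\<^sub>R) (real n) ` C) + \<phi> (L + C + (*\<^sub>R) (real n) ` D)"
    unfolding eq using C assms
    by (intro union) (auto intro!: compact_set_plus convex_set_plus convex_scaling compact_scaling)
  then show ?thesis
    using scaled_cone_Int[OF assms(4,5) _ assms(2), of "real n"] unfolding C_def by simp
qed

text \<open>Induction on the number of generating points. With one of them moved to the origin, the
  hull is a cone over the hull \<open>D\<close> of the others, and \<open>cone_difference\<close>
  expresses the increment in \<open>n\<close> by dilates of \<open>D\<close>. These occur with the
  summands \<open>L + C\<close> and \<open>L\<close>, so \<open>L\<close> must be arbitrary in the
  induction.\<close>

lemma polynomial_on_dilates: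
  assumes "finite V" "compact L" "convex L"
  shows "\<exists>p. \<forall>n. \<phi> (L + (*\<^sub>R) (real n) ` (convex hull V)) = poly p (real n)"
  using assms
proof (induction "card V" arbitrary: V L)
  case 0
  then show ?case
    by (intro exI[of _ 0]) (simp add: set_plus_def empty)
next
  case (Suc m)
  then obtain v W where W: "V = insert v W" "v \<notin> W" "card W = m" "finite W"
    by (metis card_eq_SucD card_ge_0_finite finite_insert)
  define D where "D = convex hull ((+) (- v) ` W)"
  define C where "C = convex hull insert 0 ((+) (- v) ` W)"
  have D: "compact D" "convex D" "card ((+) (- v) ` W) = m" "finite ((+) (- v) ` W)"
    unfolding D_def using W by (auto simp: finite_imp_compact_convex_hull card_image)
  have C: "compact C" "convex C"
    unfolding C_def using W by (auto simp: finite_imp_compact_convex_hull)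
  have "V = (+) v ` insert 0 ((+) (- v) ` W)"
    by (simp add: W image_image)
  then have "convex hull V = (+) v ` C"
    unfolding C_def by (metis convex_hull_translation)
  \<comment> \<open>Moving \<open>v\<close> to the origin changes the n-th sum only by the
    translation by \<open>n v\<close>, which \<phi> ignores.\<close>
  then have "L + (*\<^sub>R) (real n) ` (convex hull V) = (+) (real n *\<^sub>R v) ` (L + (*\<^sub>R) (real n) ` C)" for n
    unfolding translation_eq_singleton_plus by (simp add: scaled_translation add.left_commute)
  then have *: "\<phi> (L + (*\<^sub>R) (real n) ` (convex hull V)) = \<phi> (L + (*\<^sub>R) (real n) ` C)" for n
    using C Suc.prems
    by (simp add: translate compact_set_plus convex_set_plus convex_scaling compact_scaling)
  show ?case
  \<comment> \<open>If \<open>v\<close> is the only point, then \<open>C = {0}\<close> and the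
    sequence is constant; the cone formulas require a nonempty base.\<close>
  proof (cases "W = {}")
    case True
    then have "\<phi> (L + (*\<^sub>R) (real n) ` C) = poly [:\<phi> L:] (real n)" for n
      by (simp add: C_def set_plus_def)
    then show ?thesis
      unfolding * by blast
  next
    case False
    have C_eq: "C = convex hull insert 0 D"
      unfolding C_def D_def by (metis hull_insert)
    obtain p q where p: "\<And>n. \<phi> (L + C + (*\<^sub>R) (real n) ` D) = poly p (real n)"
      and q: "\<And>n. \<phi> (L + (*\<^sub>R) (real n) ` D) = poly q (real n)"
      using Suc.hyps(1)[OF D(3)[symmetric] D(4)] Suc.prems C
      unfolding D_def by (metis compact_set_plus convex_set_plus)
    have "D \<noteq> {}"
      using False unfolding D_def by simp
    then have "\<phi> (L + (*\<^sub>R) (real (Suc n)) ` C) - \<phi> (L + (*\<^sub>R) (real n) ` C) = poly (p - q) (real n)" for n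
      using cone_difference[of L D n] Suc.prems D p q unfolding C_eq by simp
    then show ?thesis
      unfolding * by (rule polynomial_sequence_if_difference)
  qed
qed

end

section \<open>Growth on dilates of an integral polytope\<close>

text \<open>Integrality concerns the normals and offsets; vertices may be fractional. Translating by
  a lattice vector changes each offset by an integer, which is what keeps the number of cell shapes
  finite.\<close>

definition integral_polytope :: "(real ^ 'n) set \<Rightarrow> bool" where
  "integral_polytope Q \<longleftrightarrow> bounded Q \<and>
    (\<exists>U b. finite U \<and> (\<forall>u\<in>U. \<forall>j. u $ j \<in> \<int>) \<and> Q = {x. \<forall>u\<in>U. u \<bullet> x \<le> of_int (b u)})"

lemma convex_slab: "convex {x :: real ^ 'n. a \<le> x $ j \<and> x $ j \<le> b}"
proof -
  have "{x :: real ^ 'n. a \<le> x $ j \<and> x $ j \<le> b} = (\<lambda>x. x $ j) -` {a..b}"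
    by auto
  then show ?thesis
    by (simp add: convex_linear_vimage bounded_linear_vec_nth bounded_linear.linear)
qed

lemma closed_slab: "closed {x :: real ^ 'n. a \<le> x $ j \<and> x $ j \<le> b}"
  by (intro closed_Collect_conj closed_Collect_le continuous_intros)

lemma vimage_translation: "(+) v -` S = (+) (- v) ` S" for v :: "'a::ab_group_add"
proof -
  have "x = - v + (v + x)" for x
    by simp
  then show ?thesis
    by (force intro: image_eqI)
qed

lemma scaled_halfspaces:
  assumes "c > 0"
  shows "(*\<^sub>R) c ` {x :: 'a::real_inner. \<forall>u\<in>U. u \<bullet> x \<le> b u} = {x. \<forall>u\<in>U. u \<bullet> x \<le> c * b u}"
    (is "_ ` ?P = ?R")
proof (intro set_eqI iffI)
  fix x assume "x \<in> ?R"
  then have "(1 / c) *\<^sub>R x \<in> ?P"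
    using assms by (auto simp: divide_le_eq mult.commute)
  then have "c *\<^sub>R ((1 / c) *\<^sub>R x) \<in> (*\<^sub>R) c ` ?P"
    by blast
  then show "x \<in> (*\<^sub>R) c ` ?P"
    using assms by simp
qed (use assms in \<open>auto intro!: mult_left_mono\<close>)

lemma polytope_if_integral_polytope:
  fixes Q :: "(real ^ 'n) set"
  assumes "integral_polytope Q"
  shows "polytope Q"
proof -
  obtain U and b :: "real ^ 'n \<Rightarrow> int"
    where U: "finite U" "Q = {x. \<forall>u\<in>U. u \<bullet> x \<le> of_int (b u)}" and "bounded Q"
    using assms unfolding integral_polytope_def by auto
  have "Q = \<Inter>((\<lambda>u. {x. u \<bullet> x \<le> of_int (b u)}) ` U)"
    using U(2) by auto
  then have "polyhedron Q"
    using U(1) polyhedron_halfspace_le by auto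
  then show ?thesis
    using \<open>bounded Q\<close> polytope_eq_bounded_polyhedron by blast
qed

context translation_invariant_body_valuation
begin

text \<open>Adding one unit slab costs the value of that slab and of the common face, at most
  \<open>2 * B\<close>. The induction starts from a single face, the slab of width 0.\<close>

lemma abs_le_slabs:
  assumes "compact K" "convex K"
    and "\<And>l r :: int. r = l \<or> r = l + 1 \<Longrightarrow> \<bar>\<phi> (K \<inter> {x. of_int l \<le> x $ j \<and> x $ j \<le> of_int r})\<bar> \<le> B"
  shows "\<bar>\<phi> (K \<inter> {x. of_int a \<le> x $ j \<and> x $ j \<le> of_int (a + int m)})\<bar> \<le> (2 * real m + 1) * B"
proof (induction m)
  case 0
  then show ?case
    using assms(3)[of a a] by simp
next
  case (Suc m)
  define S where "S l r = K \<inter> {x. of_int l \<le> x $ j \<and> x $ j \<le> of_int r}" for l r :: int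
  have S: "compact (S l r)" "convex (S l r)" for l r
    unfolding S_def using assms(1,2)
    by (auto intro: compact_Int_closed closed_slab convex_Int convex_slab)
  have "S a (a + int (Suc m)) = S a (a + int m) \<union> S (a + int m) (a + int m + 1)"
    unfolding S_def by auto
  moreover have "S a (a + int m) \<inter> S (a + int m) (a + int m + 1) = S (a + int m) (a + int m)"
    unfolding S_def by auto
  ultimately have "\<phi> (S a (a + int (Suc m))) + \<phi> (S (a + int m) (a + int m))
      = \<phi> (S a (a + int m)) + \<phi> (S (a + int m) (a + int m + 1))"
    using union[of "S a (a + int m)" "S (a + int m) (a + int m + 1)"]
      S[of a "a + int m"] S[of "a + int m" "a + int m + 1"] S[of a "a + int (Suc m)"] by simp
  moreover have "\<bar>\<phi> (S (a + int m) (a + int m))\<bar> \<le> B" "\<bar>\<phi> (S (a + int m) (a + int m + 1))\<bar> \<le> B"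
    unfolding S_def by (rule assms(3); simp)+
  moreover have "\<bar>\<phi> (S a (a + int m))\<bar> \<le> (2 * real m + 1) * B"
    using Suc.IH unfolding S_def .
  ultimately have "\<bar>\<phi> (S a (a + int (Suc m)))\<bar> \<le> (2 * real m + 1) * B + 2 * B"
    by linarith
  then show ?case
    unfolding S_def by (simp add: algebra_simps)
qed

text \<open>Slice along one coordinate after another. Each slice, of width 0 or 1, is again a convex
  body, to which the induction hypothesis for the remaining coordinates applies.\<close>

lemma abs_le_grid_cells:
  assumes "finite J" "compact K" "convex K"
    and "\<And>l r :: 'n \<Rightarrow> int. (\<And>j. r j = l j \<or> r j = l j + 1) \<Longrightarrow>
      \<bar>\<phi> (K \<inter> {x. \<forall>j\<in>J. of_int (l j) \<le> x $ j \<and> x $ j \<le> of_int (r j)})\<bar> \<le> B"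
    and "\<And>x j. x \<in> K \<Longrightarrow> \<bar>x $ j\<bar> \<le> real M"
  shows "\<bar>\<phi> K\<bar> \<le> (4 * real M + 1) ^ card J * B"
  using assms
proof (induction J arbitrary: K rule: finite_induct)
  case empty
  then show ?case
    using empty.prems(3)[of "\<lambda>_. 0" "\<lambda>_. 0"] by simp
next
  case (insert i J)
  have slab: "\<bar>\<phi> (K \<inter> {x. of_int a \<le> x $ i \<and> x $ i \<le> of_int c})\<bar> \<le> (4 * real M + 1) ^ card J * B"
    if ac: "c = a \<or> c = a + 1" for a c :: int
  proof (rule insert.IH)
    show "compact (K \<inter> {x. of_int a \<le> x $ i \<and> x $ i \<le> of_int c})"
      "convex (K \<inter> {x. of_int a \<le> x $ i \<and> x $ i \<le> of_int c})"
      using insert.prems(1,2) by (auto intro: compact_Int_closed closed_slab convex_Int convex_slab)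
    show "\<bar>x $ j\<bar> \<le> real M" if "x \<in> K \<inter> {x. of_int a \<le> x $ i \<and> x $ i \<le> of_int c}" for x j
      using that insert.prems(4) by auto
    fix l r :: "'n \<Rightarrow> int"
    assume lr: "\<And>j. r j = l j \<or> r j = l j + 1"
    have "K \<inter> {x. of_int a \<le> x $ i \<and> x $ i \<le> of_int c} \<inter>
        {x. \<forall>j\<in>J. of_int (l j) \<le> x $ j \<and> x $ j \<le> of_int (r j)}
      = K \<inter> {x. \<forall>j\<in>insert i J. of_int ((l(i := a)) j) \<le> x $ j \<and> x $ j \<le> of_int ((r(i := c)) j)}"
      using insert.hyps(2) by auto
    then show "\<bar>\<phi> (K \<inter> {x. of_int a \<le> x $ i \<and> x $ i \<le> of_int c} \<inter>
        {x. \<forall>j\<in>J. of_int (l j) \<le> x $ j \<and> x $ j \<le> of_int (r j)})\<bar> \<le> B"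
      using insert.prems(3)[of "r(i := c)" "l(i := a)"] lr ac by simp
  qed
  \<comment> \<open>In direction \<open>i\<close> the body is covered by \<open>2 * M\<close> unit
    slabs, so \<open>abs_le_slabs\<close> contributes the factor
    \<open>2 * (2 * M) + 1\<close>.\<close>
  have "K \<inter> {x. of_int (- int M) \<le> x $ i \<and> x $ i \<le> of_int (- int M + int (2 * M))} = K"
    using insert.prems(4)[of _ i] by (auto simp: abs_le_iff minus_le_iff)
  then have "\<bar>\<phi> K\<bar> \<le> (2 * real (2 * M) + 1) * ((4 * real M + 1) ^ card J * B)"
    using abs_le_slabs[OF insert.prems(1,2) slab, where a = "- int M" and m = "2 * M"] by metis
  then show ?case
    using insert.hyps by (simp add: mult.assoc)
qed

text \<open>Cut \<open>n Q\<close> along the unit grid. As the facet normals and the offsets are integral, only finitely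
  many shapes of pieces occur up to translation, whatever \<open>n\<close> is.\<close>

lemma growth_integral_polytope:
  assumes "integral_polytope Q"
  shows "\<exists>B. \<forall>n\<ge>1. \<bar>\<phi> ((*\<^sub>R) (real n) ` Q)\<bar> \<le> B * (real n + 1) ^ CARD('n)"
proof -
  obtain U and b :: "real ^ 'n \<Rightarrow> int"
    where U: "finite U" "\<And>u j. u \<in> U \<Longrightarrow> u $ j \<in> \<int>"
      and Q: "Q = {x. \<forall>u\<in>U. u \<bullet> x \<le> of_int (b u)}" and "bounded Q"
    using assms unfolding integral_polytope_def by auto
  define cube :: "(real ^ 'n) set" where "cube = {y. \<forall>j. 0 \<le> y $ j \<and> y $ j \<le> 1}"
  \<comment> \<open>A common bound for all \<open>u \<bullet> y\<close> with
    \<open>u \<in> U\<close> and \<open>y\<close> in the unit cube.\<close>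
  define S where "S = \<lceil>\<Sum>u\<in>U. \<Sum>j\<in>UNIV. \<bar>u $ j\<bar>\<rceil>"
  have "0 \<le> (\<Sum>u\<in>U. \<Sum>j\<in>UNIV. \<bar>u $ j\<bar>)"
    by (intro sum_nonneg) auto
  then have "S \<ge> 0"
    unfolding S_def by linarith
  have S: "\<bar>u \<bullet> y\<bar> \<le> of_int S" if "u \<in> U" "y \<in> cube" for u y
  proof -
    have "\<bar>u \<bullet> y\<bar> \<le> (\<Sum>j\<in>UNIV. \<bar>u $ j * y $ j\<bar>)"
      unfolding inner_vec_def by simp
    also have "\<dots> \<le> (\<Sum>j\<in>UNIV. \<bar>u $ j\<bar>)"
      using that by (intro sum_mono) (auto simp: abs_mult cube_def intro: mult_left_le)
    also have "\<dots> \<le> (\<Sum>u\<in>U. \<Sum>j\<in>UNIV. \<bar>u $ j\<bar>)"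
      using U(1) that(1) by (intro member_le_sum[of u U "\<lambda>u. \<Sum>j\<in>UNIV. \<bar>u $ j\<bar>"]) (auto intro: sum_nonneg)
    also have "\<dots> \<le> of_int S"
      unfolding S_def by simp
    finally show ?thesis .
  qed
  \<comment> \<open>The shape of a cell whose lower corner has been moved to the origin:
    \<open>c\<close> holds the offsets of the halfspaces and \<open>e\<close> the edge lengths, each
    0 or 1. The family \<open>\<X>\<close> is finite because its offsets range only over
    \<open>{- S - 1..S}\<close>.\<close>
  define X where "X c e = {y. (\<forall>u\<in>U. u \<bullet> y \<le> of_int (c u)) \<and> (\<forall>j. 0 \<le> y $ j \<and> y $ j \<le> of_int (e j))}"
    for c :: "real ^ 'n \<Rightarrow> int" and e :: "'n \<Rightarrow> int"
  define \<X> where "\<X> = (\<lambda>(c, e). X c e) ` ((U \<rightarrow>\<^sub>E {- S - 1..S}) \<times> (UNIV \<rightarrow>\<^sub>E {0, 1}))"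
  define B where "B = (\<Sum>Y\<in>\<X>. \<bar>\<phi> Y\<bar>)"
  have "finite \<X>"
    unfolding \<X>_def using U(1) by (intro finite_imageI finite_SigmaI finite_PiE) auto
  then have B: "\<bar>\<phi> Y\<bar> \<le> B" if "Y \<in> \<X>" for Y
    unfolding B_def using that by (intro member_le_sum) auto
  have "B \<ge> 0"
    unfolding B_def by (simp add: sum_nonneg)
  obtain M0 where "\<And>x. x \<in> Q \<Longrightarrow> norm x \<le> M0"
    using \<open>bounded Q\<close> unfolding bounded_iff by blast
  moreover obtain M :: nat where "M0 \<le> real M"
    using real_arch_simple by blast
  ultimately have M: "\<bar>x $ j\<bar> \<le> real M" if "x \<in> Q" for x j
    using component_le_norm_cart[of x j] that by force
  have "\<bar>\<phi> ((*\<^sub>R) (real n) ` Q)\<bar> \<le> (4 * real (n * M) + 1) ^ card (UNIV :: 'n set) * B" if "n \<ge> 1" for n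
  proof (rule abs_le_grid_cells)
    have "compact Q" "convex Q"
      using polytope_if_integral_polytope[OF assms] polytope_imp_compact polytope_imp_convex by auto
    then show "compact ((*\<^sub>R) (real n) ` Q)" "convex ((*\<^sub>R) (real n) ` Q)"
      by (auto intro: compact_scaling convex_scaling)
    show "\<bar>x $ j\<bar> \<le> real (n * M)" if "x \<in> (*\<^sub>R) (real n) ` Q" for x j
      using that M by (auto simp: abs_mult intro!: mult_left_mono)
    have nQ: "(*\<^sub>R) (real n) ` Q = {x. \<forall>u\<in>U. u \<bullet> x \<le> of_int (int n * b u)}"
      unfolding Q using scaled_halfspaces[of "real n"] \<open>n \<ge> 1\<close> by simp
    fix l r :: "'n \<Rightarrow> int"
    assume lr: "\<And>j. r j = l j \<or> r j = l j + 1"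
    define v :: "real ^ 'n" where "v = (\<chi> j. of_int (l j))"
    \<comment> \<open>For \<open>u \<in> U\<close> the floor is exact, since both \<open>u\<close>
      and \<open>v\<close> are integral.\<close>
    define c where "c u = int n * b u - \<lfloor>u \<bullet> v\<rfloor>" for u
    have c: "of_int (c u) = of_int (int n * b u) - u \<bullet> v" if "u \<in> U" for u
    proof -
      have "u \<bullet> v \<in> \<int>"
        unfolding inner_vec_def v_def using U(2)[OF that] by (intro Ints_sum) auto
      then show ?thesis
        unfolding c_def by auto
    qed
    \<comment> \<open>Clamping does not change the cell: on the cube, an offset of \<open>S\<close>
      or more imposes nothing, and an offset of \<open>- S - 1\<close> or less cannot be
      satisfied.\<close>
    define c' where "c' = restrict (\<lambda>u. max (- S - 1) (min S (c u))) U"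
    define e where "e j = r j - l j" for j
    have "X c e = X c' e"
    proof -
      have "u \<bullet> y \<le> of_int (c u) \<longleftrightarrow> u \<bullet> y \<le> of_int (c' u)"
        if u: "u \<in> U" and y: "\<And>j. 0 \<le> y $ j \<and> y $ j \<le> of_int (e j)" for u y
      proof -
        have "y $ j \<le> 1" for j
          using y[of j] lr[of j] by (auto simp: e_def)
        then have "\<bar>u \<bullet> y\<bar> \<le> of_int S"
          using S[OF u, of y] y unfolding cube_def by auto
        then show ?thesis
          using u \<open>S \<ge> 0\<close> unfolding c'_def by (auto simp: max_def min_def)
      qed
      then show ?thesis
        unfolding X_def by blast
    qed
    also have "\<dots> \<in> \<X>"
    proof -
      have "c' \<in> U \<rightarrow>\<^sub>E {- S - 1..S}"
        unfolding c'_def using \<open>S \<ge> 0\<close> by auto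
      moreover have "e \<in> UNIV \<rightarrow>\<^sub>E {0, 1}"
        unfolding e_def PiE_UNIV_domain using lr by (force simp: Pi_def)
      ultimately show ?thesis
        unfolding \<X>_def by force
    qed
    finally have "\<bar>\<phi> (X c e)\<bar> \<le> B"
      by (rule B)
    moreover have "X c e = (+) (- v) ` ((*\<^sub>R) (real n) ` Q
        \<inter> {x. \<forall>j\<in>UNIV. of_int (l j) \<le> x $ j \<and> x $ j \<le> of_int (r j)})" (is "_ = _ ` ?L")
    proof -
      have "u \<bullet> y \<le> of_int (c u) \<longleftrightarrow> u \<bullet> (v + y) \<le> of_int (int n * b u)" if "u \<in> U" for u y
        using c[OF that] unfolding inner_add_right by linarith
      moreover have "0 \<le> y $ j \<and> y $ j \<le> of_int (e j) \<longleftrightarrow>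
          of_int (l j) \<le> (v + y) $ j \<and> (v + y) $ j \<le> of_int (r j)" for y j
        unfolding e_def v_def by auto
      ultimately have "y \<in> X c e \<longleftrightarrow> v + y \<in> ?L" for y
        unfolding nQ X_def by auto
      then show ?thesis
        unfolding vimage_translation[symmetric] by blast
    qed
    moreover have "compact ?L" "convex ?L"
    proof -
      have "?L = (*\<^sub>R) (real n) ` Q \<inter> (\<Inter>j. {x. of_int (l j) \<le> x $ j \<and> x $ j \<le> of_int (r j)})"
        by auto
      then show "compact ?L" "convex ?L"
        using \<open>compact ((*\<^sub>R) (real n) ` Q)\<close> \<open>convex ((*\<^sub>R) (real n) ` Q)\<close>
        by (auto intro!: compact_Int_closed closed_INT closed_slab convex_Int convex_INT convex_slab)
    qed
    ultimately show "\<bar>\<phi> ?L\<bar> \<le> B"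
      using translate[of ?L "- v"] by simp
  qed simp
  moreover have "(4 * real (n * M) + 1) ^ CARD('n) * B \<le> (4 * real M + 1) ^ CARD('n) * B * (real n + 1) ^ CARD('n)" for n
  proof -
    have "4 * real (n * M) + 1 \<le> (4 * real M + 1) * (real n + 1)"
      by (simp add: algebra_simps)
    then have "(4 * real (n * M) + 1) ^ CARD('n) \<le> ((4 * real M + 1) * (real n + 1)) ^ CARD('n)"
      by (intro power_mono) auto
    then have "(4 * real (n * M) + 1) ^ CARD('n) * B \<le> ((4 * real M + 1) * (real n + 1)) ^ CARD('n) * B"
      using \<open>B \<ge> 0\<close> by (rule mult_right_mono)
    then show ?thesis
      by (simp add: power_mult_distrib mult_ac)
  qed
  ultimately show ?thesis
    using order_trans by (intro exI allI impI) blast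
qed

end

section \<open>Approximation by integral polytopes\<close>

text \<open>Rounding up gives approximations from outside, for offsets of halfspaces and for
  dilation factors. Applied to \<open>- f x\<close> it rounds function values down.\<close>

definition dyadic_ceiling :: "nat \<Rightarrow> real \<Rightarrow> real" where
  "dyadic_ceiling i y = of_int \<lceil>2 ^ i * y\<rceil> / 2 ^ i"

lemma dyadic_ceiling_ge: "y \<le> dyadic_ceiling i y"
  unfolding dyadic_ceiling_def by (simp add: field_simps)

text \<open>The dyadic grid of level \<open>i\<close> is contained in that of level
  \<open>Suc i\<close>, so the finer grid has the closer upper neighbour.\<close>

lemma dyadic_ceiling_Suc_le: "dyadic_ceiling (Suc i) y \<le> dyadic_ceiling i y"
proof -
  have "2 ^ Suc i * y \<le> of_int (2 * \<lceil>2 ^ i * y\<rceil>)"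
    using le_of_int_ceiling[of "2 ^ i * y"] by simp
  then have "\<lceil>2 ^ Suc i * y\<rceil> \<le> 2 * \<lceil>2 ^ i * y\<rceil>"
    by (rule ceiling_le)
  then have "real_of_int \<lceil>2 ^ Suc i * y\<rceil> \<le> 2 * of_int \<lceil>2 ^ i * y\<rceil>"
    by linarith
  then show ?thesis
    unfolding dyadic_ceiling_def by (simp add: field_simps)
qed

lemma dyadic_ceiling_tendsto: "(\<lambda>i. dyadic_ceiling i y) \<longlonglongrightarrow> y"
proof (rule real_tendsto_sandwich[OF _ _ tendsto_const])
  show "(\<lambda>i. y + (1 / 2) ^ i) \<longlonglongrightarrow> y"
    using tendsto_add[OF tendsto_const LIMSEQ_power_zero[of "1 / 2 :: real"], of y] by simp
  show "\<forall>\<^sub>F i in sequentially. dyadic_ceiling i y \<le> y + (1 / 2) ^ i"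
  proof (intro always_eventually allI)
    fix i
    have "of_int \<lceil>2 ^ i * y\<rceil> \<le> 2 ^ i * y + 1"
      by linarith
    then show "dyadic_ceiling i y \<le> y + (1 / 2) ^ i"
      unfolding dyadic_ceiling_def by (simp add: field_simps)
  qed
qed (auto simp: dyadic_ceiling_ge)

text \<open>Multiply a real separating functional by a large \<open>n\<close> and round its entries.
  The rounding error contributes at most \<open>CARD('n) * R\<close> on differences
  \<open>x - y\<close>, while the gap \<open>n * \<delta>\<close> grows without bound.\<close>

lemma separating_integral_functional:
  fixes K :: "(real ^ 'n) set"
  assumes "compact K" "convex K" "x \<notin> K"
  obtains u \<epsilon> where "\<And>j. u $ j \<in> \<int>" "\<epsilon> > 0" "\<And>y. y \<in> K \<Longrightarrow> u \<bullet> y \<le> u \<bullet> x - \<epsilon>"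
proof -
  obtain a \<beta> where "a \<bullet> x < \<beta>" and \<beta>: "\<And>y. y \<in> K \<Longrightarrow> a \<bullet> y > \<beta>"
    using separating_hyperplane_closed_point[of K x] assms compact_imp_closed by blast
  define \<delta> where "\<delta> = \<beta> - a \<bullet> x"
  have "\<delta> > 0"
    unfolding \<delta>_def using \<open>a \<bullet> x < \<beta>\<close> by simp
  have "bounded ((\<lambda>y. x - y) ` K)"
    using assms(1)
    by (intro compact_imp_bounded compact_continuous_image continuous_intros)
  then obtain R where R: "\<And>y. y \<in> K \<Longrightarrow> norm (x - y) \<le> R"
    unfolding bounded_iff by blast
  obtain n :: nat where "real n > (real CARD('n) * R) / \<delta>"
    using reals_Archimedean2 by blast
  then have n: "real n * \<delta> - real CARD('n) * R > 0"
    using \<open>\<delta> > 0\<close> by (simp add: divide_less_eq)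
  \<comment> \<open>The sign is reversed because \<open>a\<close> is larger on \<open>K\<close> than
    at \<open>x\<close>.\<close>
  define u :: "real ^ 'n" where "u = (\<chi> j. of_int \<lfloor>- (real n * a $ j)\<rfloor>)"
  have "norm (u + real n *\<^sub>R a) \<le> (\<Sum>j\<in>UNIV. \<bar>(u + real n *\<^sub>R a) $ j\<bar>)"
    by (rule norm_le_l1_cart)
  also have "\<dots> \<le> (\<Sum>j\<in>(UNIV :: 'n set). 1)"
  proof (rule sum_mono)
    fix j
    have "of_int \<lfloor>- (real n * a $ j)\<rfloor> \<le> - (real n * a $ j)" "of_int \<lfloor>- (real n * a $ j)\<rfloor> > - (real n * a $ j) - 1"
      by linarith+
    then show "\<bar>(u + real n *\<^sub>R a) $ j\<bar> \<le> 1"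
      unfolding u_def abs_le_iff by (simp only: vector_add_component vector_scaleR_component
          vec_lambda_beta real_scaleR_def) linarith
  qed
  finally have u: "norm (u + real n *\<^sub>R a) \<le> real CARD('n)"
    by simp
  show thesis
  proof
    show "u $ j \<in> \<int>" for j
      unfolding u_def by simp
    show "real n * \<delta> - real CARD('n) * R > 0"
      by (rule n)
    show "u \<bullet> y \<le> u \<bullet> x - (real n * \<delta> - real CARD('n) * R)" if "y \<in> K" for y
    proof -
      have "\<bar>(u + real n *\<^sub>R a) \<bullet> (x - y)\<bar> \<le> norm (u + real n *\<^sub>R a) * norm (x - y)"
        by (rule Cauchy_Schwarz_ineq2)
      also have "\<dots> \<le> real CARD('n) * R"
        using u R[OF that] by (intro mult_mono) auto
      finally have "- (real CARD('n) * R) \<le> (u + real n *\<^sub>R a) \<bullet> (x - y)"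
        by linarith
      moreover have "(u + real n *\<^sub>R a) \<bullet> (x - y) = u \<bullet> x - u \<bullet> y - real n * (a \<bullet> y - a \<bullet> x)"
        by (simp add: inner_add_left inner_diff_right algebra_simps)
      moreover have "real n * \<delta> \<le> real n * (a \<bullet> y - a \<bullet> x)"
        using \<beta>[OF that] unfolding \<delta>_def by (intro mult_left_mono) auto
      ultimately show ?thesis
        by linarith
    qed
  qed
qed

lemma finite_bounded_integral_vectors:
  "finite {u :: real ^ 'n. \<forall>j. u $ j \<in> \<int> \<and> \<bar>u $ j\<bar> \<le> real m}"
proof (rule finite_subset)
  show "{u :: real ^ 'n. \<forall>j. u $ j \<in> \<int> \<and> \<bar>u $ j\<bar> \<le> real m}
      \<subseteq> (\<lambda>f. \<chi> j. of_int (f j)) ` (UNIV \<rightarrow>\<^sub>E {- int m..int m})"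
  proof
    fix u :: "real ^ 'n"
    assume u: "u \<in> {u. \<forall>j. u $ j \<in> \<int> \<and> \<bar>u $ j\<bar> \<le> real m}"
    have "\<lfloor>u $ j\<rfloor> \<in> {- int m..int m}" for j
    proof -
      have "\<bar>u $ j\<bar> \<le> real m"
        using u by blast
      then show ?thesis
        by (auto simp: le_floor_iff floor_le_iff abs_le_iff)
    qed
    moreover have "u = (\<chi> j. of_int \<lfloor>u $ j\<rfloor>)"
      using u by (simp add: vec_eq_iff)
    ultimately show "u \<in> (\<lambda>f. \<chi> j. of_int (f j)) ` (UNIV \<rightarrow>\<^sub>E {- int m..int m})"
      by (intro image_eqI[of _ _ "\<lambda>j. \<lfloor>u $ j\<rfloor>"]) (auto simp: PiE_UNIV_domain)
  qed
qed (intro finite_imageI finite_PiE; simp)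

text \<open>Bound \<open>K\<close> by the halfspaces of finitely many integral normals, with the
  support function \<open>h\<close> rounded up to multiples of \<open>1 / 2 ^ i\<close>; scaling by
  \<open>2 ^ i\<close> makes the offsets integral. As \<open>i\<close> grows there are more normals
  and tighter offsets, and integral functionals separate every outside point from
  \<open>K\<close>.\<close>

lemma decreasing_integral_approximation:
  fixes K :: "(real ^ 'n) set"
  assumes "compact K" "convex K" "K \<noteq> {}"
  obtains Q where "\<And>i. integral_polytope (Q i)"
    and "\<And>i. (*\<^sub>R) (1 / 2 ^ Suc i) ` Q (Suc i) \<subseteq> (*\<^sub>R) (1 / 2 ^ i) ` Q i"
    and "(\<Inter>i. (*\<^sub>R) (1 / 2 ^ i) ` Q i) = K"
proof -
  \<comment> \<open>The bound \<open>Suc i\<close> puts the signed unit vectors into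
    \<open>U 0\<close> already, so that every \<open>Q i\<close> is bounded.\<close>
  define U where "U i = {u :: real ^ 'n. \<forall>j. u $ j \<in> \<int> \<and> \<bar>u $ j\<bar> \<le> real (Suc i)}" for i
  define h where "h u = (SUP y\<in>K. u \<bullet> y)" for u
  define Q where "Q i = {x. \<forall>u\<in>U i. u \<bullet> x \<le> of_int \<lceil>2 ^ i * h u\<rceil>}" for i
  have h: "u \<bullet> y \<le> h u" if "y \<in> K" for u y
  proof -
    have "compact ((\<lambda>y. u \<bullet> y) ` K)"
      using assms(1) by (intro compact_continuous_image continuous_intros)
    then have "bdd_above ((\<lambda>y. u \<bullet> y) ` K)"
      by (intro bounded_imp_bdd_above compact_imp_bounded)
    then show ?thesis
      unfolding h_def using that by (rule cSUP_upper2) auto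
  qed
  have Q: "(*\<^sub>R) (1 / 2 ^ i) ` Q i = {x. \<forall>u\<in>U i. u \<bullet> x \<le> dyadic_ceiling i (h u)}" for i
    unfolding Q_def dyadic_ceiling_def by (subst scaled_halfspaces) auto
  show thesis
  proof
    show "integral_polytope (Q i)" for i
    proof -
      have "bounded (Q i)"
      proof (rule boundedI)
        fix x assume x: "x \<in> Q i"
        have "\<bar>x $ j\<bar> \<le> \<bar>of_int \<lceil>2 ^ i * h (axis j 1)\<rceil>\<bar> + \<bar>of_int \<lceil>2 ^ i * h (- axis j 1)\<rceil>\<bar>" for j
        proof -
          have "axis j 1 \<in> U i" "- axis j 1 \<in> U i"
            unfolding U_def by (auto simp: axis_def)
          then have "axis j 1 \<bullet> x \<le> of_int \<lceil>2 ^ i * h (axis j 1)\<rceil>"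
            "- axis j 1 \<bullet> x \<le> of_int \<lceil>2 ^ i * h (- axis j 1)\<rceil>"
            using x unfolding Q_def by blast+
          then show ?thesis
            by (simp add: inner_axis')
        qed
        then have "(\<Sum>j\<in>UNIV. \<bar>x $ j\<bar>)
            \<le> (\<Sum>j\<in>UNIV. \<bar>of_int \<lceil>2 ^ i * h (axis j 1)\<rceil>\<bar> + \<bar>of_int \<lceil>2 ^ i * h (- axis j 1)\<rceil>\<bar>)"
          by (rule sum_mono)
        then show "norm x
            \<le> (\<Sum>j\<in>UNIV. \<bar>of_int \<lceil>2 ^ i * h (axis j 1)\<rceil>\<bar> + \<bar>of_int \<lceil>2 ^ i * h (- axis j 1)\<rceil>\<bar>)"
          using norm_le_l1_cart[of x] by (rule order_trans[rotated])
      qed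
      moreover have "finite (U i)"
        unfolding U_def by (rule finite_bounded_integral_vectors)
      ultimately show ?thesis
        unfolding integral_polytope_def Q_def U_def
        by (intro conjI exI[of _ "{u. \<forall>j. u $ j \<in> \<int> \<and> \<bar>u $ j\<bar> \<le> real (Suc i)}"]
            exI[of _ "\<lambda>u. \<lceil>2 ^ i * h u\<rceil>"]) auto
    qed
    show "(*\<^sub>R) (1 / 2 ^ Suc i) ` Q (Suc i) \<subseteq> (*\<^sub>R) (1 / 2 ^ i) ` Q i" for i
    proof -
      have "U i \<subseteq> U (Suc i)"
        unfolding U_def by (auto intro: order_trans)
      then show ?thesis
        unfolding Q using dyadic_ceiling_Suc_le order_trans by blast
    qed
    show "(\<Inter>i. (*\<^sub>R) (1 / 2 ^ i) ` Q i) = K"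
    proof (intro subset_antisym subsetI)
      fix x assume "x \<in> K"
      then show "x \<in> (\<Inter>i. (*\<^sub>R) (1 / 2 ^ i) ` Q i)"
        unfolding Q using h dyadic_ceiling_ge order_trans by blast
    next
      fix x assume x: "x \<in> (\<Inter>i. (*\<^sub>R) (1 / 2 ^ i) ` Q i)"
      show "x \<in> K"
      proof (rule ccontr)
        assume "x \<notin> K"
        then obtain u \<epsilon> where u: "\<And>j. u $ j \<in> \<int>" "\<epsilon> > 0" "\<And>y. y \<in> K \<Longrightarrow> u \<bullet> y \<le> u \<bullet> x - \<epsilon>"
          using separating_integral_functional[OF assms(1,2)] by metis
        obtain m :: nat where m: "norm u \<le> real m"
          using real_arch_simple by blast
        have "u \<in> U i" if "i \<ge> m" for i
        proof -
          have "\<bar>u $ j\<bar> \<le> real (Suc i)" for j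
            using component_le_norm_cart[of u j] m that by simp
          then show ?thesis
            unfolding U_def using u(1) by blast
        qed
        \<comment> \<open>From level \<open>m\<close> on, \<open>u\<close> is among the normals;
          letting its rounded offset tend to \<open>h u\<close> contradicts the separation.\<close>
        then have "u \<bullet> x \<le> dyadic_ceiling i (h u)" if "i \<ge> m" for i
          using x that unfolding Q by blast
        then have "u \<bullet> x \<le> h u"
          by (intro LIMSEQ_le_const[OF dyadic_ceiling_tendsto]) blast
        also have "h u \<le> u \<bullet> x - \<epsilon>"
          unfolding h_def using assms(3) u(3) by (intro cSUP_least) auto
        finally show False
          using u(2) by simp
      qed
    qed
  qed
qed

section \<open>Dilates of convex bodies\<close>

lemma pos_dyadic_ceiling_ratio:
  assumes "y > 0"
  obtains a where "a > 0" "dyadic_ceiling i y = real a / real (2 ^ i)"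
proof
  have "\<lceil>2 ^ i * y\<rceil> > 0"
    using assms by simp
  then show "nat \<lceil>2 ^ i * y\<rceil> > 0" "dyadic_ceiling i y = real (nat \<lceil>2 ^ i * y\<rceil>) / real (2 ^ i)"
    unfolding dyadic_ceiling_def by simp_all
qed

lemma scaled_INT:
  fixes S :: "nat \<Rightarrow> 'a::real_vector set"
  assumes "c \<noteq> 0"
  shows "(*\<^sub>R) c ` (\<Inter>i. S i) = (\<Inter>i. (*\<^sub>R) c ` S i)"
  using assms by (intro image_INT[of _ UNIV]) (auto simp: inj_on_def)

lemma scaled_subset_if_star:
  fixes K :: "'a::real_vector set"
  assumes "convex K" "0 \<in> K" "0 < c" "c \<le> d"
  shows "(*\<^sub>R) c ` K \<subseteq> (*\<^sub>R) d ` K"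
proof
  fix x assume "x \<in> (*\<^sub>R) c ` K"
  then obtain k where k: "k \<in> K" "x = c *\<^sub>R k"
    by blast
  have "(c / d) *\<^sub>R k + (1 - c / d) *\<^sub>R 0 \<in> K"
    using assms k by (intro convexD) (auto simp: divide_le_eq)
  moreover have "x = d *\<^sub>R ((c / d) *\<^sub>R k + (1 - c / d) *\<^sub>R 0)"
    using assms k by simp
  ultimately show "x \<in> (*\<^sub>R) d ` K"
    by blast
qed

text \<open>Continuity is stated from above: a decreasing intersection of compact convex sets is
  again compact and convex, whereas an increasing union need not be compact.\<close>

locale continuous_body_valuation = translation_invariant_body_valuation \<phi>
  for \<phi> :: "(real ^ 'n) set \<Rightarrow> real" +
  assumes continuous_above: "\<lbrakk>\<And>i::nat. compact (K i); \<And>i. convex (K i); \<And>i. K (Suc i) \<subseteq> K i\<rbrakk>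
    \<Longrightarrow> (\<lambda>i. \<phi> (K i)) \<longlonglongrightarrow> \<phi> (\<Inter>i. K i)"
begin

text \<open>All dilates involved are integer multiples of \<open>Q'\<close>, the polytope
  \<open>Q\<close> shrunk by \<open>q * s\<close>, so a single polynomial \<open>p\<close> describes
  their values. It remains to bound its degree and interpolate.\<close>

lemma lagrange_rational_dilate_integral_polytope:
  assumes Q: "integral_polytope Q" and "q > 0" "s > 0"
  shows "\<phi> ((*\<^sub>R) (real a / real q) ` (*\<^sub>R) (1 / real s) ` Q) =
    (\<Sum>j=1..Suc CARD('n). poly (lagrange CARD('n) j) (real a / real q) *
      \<phi> ((*\<^sub>R) (real j) ` (*\<^sub>R) (1 / real s) ` Q))"
proof -
  define Q' where "Q' = (*\<^sub>R) (1 / real (q * s)) ` Q"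
  have "polytope Q'"
    unfolding Q'_def using polytope_if_integral_polytope[OF Q] by (rule polytope_scaling)
  then obtain V where "finite V" "Q' = convex hull V"
    unfolding polytope_def by blast
  moreover have "{0} + S = S" for S :: "(real ^ 'n) set"
    using add_0_left[of S] by simp
  ultimately obtain p where p: "\<And>n. \<phi> ((*\<^sub>R) (real n) ` Q') = poly p (real n)"
    using polynomial_on_dilates[of V "{0}"] by auto
  obtain B where B: "\<And>n. n \<ge> 1 \<Longrightarrow> \<bar>\<phi> ((*\<^sub>R) (real n) ` Q)\<bar> \<le> B * (real n + 1) ^ CARD('n)"
    using growth_integral_polytope[OF Q] by blast
  \<comment> \<open>Growth is known for multiples of \<open>Q\<close>, that is, for \<open>p\<close>
    at multiples of \<open>q * s\<close>. The linear substitution preserves the degree.\<close>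
  have "degree (pcompose p [:0, real (q * s):]) \<le> CARD('n)"
  proof (rule degree_le_if_growth)
    fix n :: nat
    assume "n \<ge> 1"
    have "(*\<^sub>R) (real (n * (q * s))) ` Q' = (*\<^sub>R) (real n) ` Q"
      unfolding Q'_def image_image scaleR_scaleR using assms by simp
    then have "poly p (real (n * (q * s))) = \<phi> ((*\<^sub>R) (real n) ` Q)"
      using p by metis
    then show "\<bar>poly (pcompose p [:0, real (q * s):]) (real n)\<bar> \<le> B * (real n + 1) ^ CARD('n)"
      using B[OF \<open>n \<ge> 1\<close>] by (simp add: poly_pcompose mult.commute mult.left_commute)
  qed
  then have "degree p \<le> CARD('n)"
    using assms by (simp add: degree_pcompose)
  then have deg: "degree (pcompose p [:0, real q:]) \<le> CARD('n)"
    using assms by (simp add: degree_pcompose)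
  \<comment> \<open>Used with \<open>m = q\<close> for the factor \<open>a / q\<close> and with
    \<open>m = 1\<close> for the nodes.\<close>
  have eq: "\<phi> ((*\<^sub>R) (real n / real m) ` (*\<^sub>R) (1 / real s) ` Q) = poly (pcompose p [:0, real q:]) (real n / real m)"
    if "m dvd q" "m > 0" for n m
  proof -
    obtain k where k: "q = m * k"
      using \<open>m dvd q\<close> by (rule dvdE)
    then have "real n / real m * (1 / real s) = real (n * k) * (1 / real (q * s))"
      using assms that by (simp add: field_simps)
    then have "(*\<^sub>R) (real n / real m) ` (*\<^sub>R) (1 / real s) ` Q = (*\<^sub>R) (real (n * k)) ` Q'"
      unfolding Q'_def image_image scaleR_scaleR by (simp only:)
    moreover have "real q * (real n / real m) = real (n * k)"
      using k that by simp
    ultimately show ?thesis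
      using p[of "n * k"] by (simp add: poly_pcompose mult.commute)
  qed
  have "\<phi> ((*\<^sub>R) (real j) ` (*\<^sub>R) (1 / real s) ` Q) = poly (pcompose p [:0, real q:]) (real j)" for j
    using eq[of 1 j] by simp
  then show ?thesis
    using lagrange_interpolation[OF deg, of "real a / real q"] eq[of q a] assms
    by (simp only: dvd_refl)
qed

text \<open>Both sides pass to the limit along polytopes decreasing to \<open>K\<close>, since
  dilation commutes with the intersection and only finitely many dilates occur.\<close>

lemma lagrange_rational_dilate:
  assumes "compact K" "convex K" "a > 0" "q > 0"
  shows "\<phi> ((*\<^sub>R) (real a / real q) ` K) =
    (\<Sum>j=1..Suc CARD('n). poly (lagrange CARD('n) j) (real a / real q) * \<phi> ((*\<^sub>R) (real j) ` K))"
proof (cases "K = {}")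
  case True
  then show ?thesis
    by (simp add: empty)
next
  case False
  then obtain Q where Q: "\<And>i. integral_polytope (Q i)"
    "\<And>i. (*\<^sub>R) (1 / 2 ^ Suc i) ` Q (Suc i) \<subseteq> (*\<^sub>R) (1 / 2 ^ i) ` Q i"
    "(\<Inter>i. (*\<^sub>R) (1 / 2 ^ i) ` Q i) = K"
    using decreasing_integral_approximation[OF assms(1,2)] by blast
  define P where "P i = (*\<^sub>R) (1 / real (2 ^ i)) ` Q i" for i
  have P: "compact (P i)" "convex (P i)" "P (Suc i) \<subseteq> P i" for i
  proof -
    have "polytope (P i)"
      unfolding P_def using polytope_if_integral_polytope[OF Q(1)] by (rule polytope_scaling)
    then show "compact (P i)" "convex (P i)"
      by (rule polytope_imp_compact polytope_imp_convex)+
    show "P (Suc i) \<subseteq> P i"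
      unfolding P_def using Q(2)[of i] by simp
  qed
  have lim: "(\<lambda>i. \<phi> ((*\<^sub>R) c ` P i)) \<longlonglongrightarrow> \<phi> ((*\<^sub>R) c ` K)" if "c > 0" for c
  proof -
    have "(*\<^sub>R) c ` K = (\<Inter>i. (*\<^sub>R) c ` P i)"
      using scaled_INT[of c P] that Q(3) unfolding P_def by simp
    moreover have "(\<lambda>i. \<phi> ((*\<^sub>R) c ` P i)) \<longlonglongrightarrow> \<phi> (\<Inter>i. (*\<^sub>R) c ` P i)"
      using P by (intro continuous_above compact_scaling convex_scaling image_mono)
    ultimately show ?thesis
      by simp
  qed
  have "(\<lambda>i. \<Sum>j=1..Suc CARD('n). poly (lagrange CARD('n) j) (real a / real q) * \<phi> ((*\<^sub>R) (real j) ` P i))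
    \<longlonglongrightarrow> (\<Sum>j=1..Suc CARD('n). poly (lagrange CARD('n) j) (real a / real q) * \<phi> ((*\<^sub>R) (real j) ` K))"
    by (intro tendsto_sum tendsto_mult tendsto_const lim) simp
  moreover have "\<phi> ((*\<^sub>R) (real a / real q) ` P i) =
      (\<Sum>j=1..Suc CARD('n). poly (lagrange CARD('n) j) (real a / real q) * \<phi> ((*\<^sub>R) (real j) ` P i))" for i
    unfolding P_def using assms Q(1) by (intro lagrange_rational_dilate_integral_polytope) simp_all
  ultimately show ?thesis
    using LIMSEQ_unique[OF lim[of "real a / real q"]] assms by simp
qed

text \<open>Approximate \<open>c\<close> by dyadic rationals from above. Because
  \<open>0 \<in> K\<close>, the corresponding dilates of \<open>K\<close> decrease, and because
  \<open>K\<close> is closed, their intersection is the dilate by \<open>c\<close>; continuity from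
  above applies.\<close>

lemma lagrange_dilate_star:
  assumes "compact K" "convex K" "0 \<in> K" "c > 0"
  shows "\<phi> ((*\<^sub>R) c ` K) =
    (\<Sum>j=1..Suc CARD('n). poly (lagrange CARD('n) j) c * \<phi> ((*\<^sub>R) (real j) ` K))"
proof -
  define d where "d i = dyadic_ceiling i c" for i
  have d: "d i \<ge> c" "d (Suc i) \<le> d i" for i
    unfolding d_def by (rule dyadic_ceiling_ge dyadic_ceiling_Suc_le)+
  then have d_pos: "d i > 0" for i
    using assms(4) less_le_trans by blast
  have "d \<longlonglongrightarrow> c"
    unfolding d_def by (rule dyadic_ceiling_tendsto)
  have "(*\<^sub>R) c ` K = (\<Inter>i. (*\<^sub>R) (d i) ` K)"
  proof (intro subset_antisym subsetI)
    fix x assume "x \<in> (*\<^sub>R) c ` K"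
    then show "x \<in> (\<Inter>i. (*\<^sub>R) (d i) ` K)"
      using scaled_subset_if_star[OF assms(2,3,4) d(1)] by blast
  next
    fix x assume x: "x \<in> (\<Inter>i. (*\<^sub>R) (d i) ` K)"
    have "inverse (d i) *\<^sub>R x \<in> K" for i
    proof -
      obtain k where "k \<in> K" "x = d i *\<^sub>R k"
        using x by blast
      then show ?thesis
        using d_pos[of i] by simp
    qed
    moreover have "(\<lambda>i. inverse (d i) *\<^sub>R x) \<longlonglongrightarrow> inverse c *\<^sub>R x"
      using \<open>d \<longlonglongrightarrow> c\<close> assms(4) by (intro tendsto_intros) auto
    ultimately have "inverse c *\<^sub>R x \<in> K"
      by (rule closed_sequentially[OF compact_imp_closed[OF assms(1)]])
    then have "c *\<^sub>R (inverse c *\<^sub>R x) \<in> (*\<^sub>R) c ` K"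
      by blast
    then show "x \<in> (*\<^sub>R) c ` K"
      using assms(4) by simp
  qed
  then have "(\<lambda>i. \<phi> ((*\<^sub>R) (d i) ` K)) \<longlonglongrightarrow> \<phi> ((*\<^sub>R) c ` K)"
    using continuous_above[of "\<lambda>i. (*\<^sub>R) (d i) ` K"] assms scaled_subset_if_star[OF assms(2,3) d_pos d(2)]
    by (simp add: compact_scaling convex_scaling)
  moreover have "\<phi> ((*\<^sub>R) (d i) ` K) =
      (\<Sum>j=1..Suc CARD('n). poly (lagrange CARD('n) j) (d i) * \<phi> ((*\<^sub>R) (real j) ` K))" for i
  proof -
    obtain a where "a > 0" "d i = real a / real (2 ^ i)"
      unfolding d_def using pos_dyadic_ceiling_ratio[OF assms(4)] by metis
    then show ?thesis
      using lagrange_rational_dilate[OF assms(1,2), of a "2 ^ i"] by simp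
  qed
  moreover have "(\<lambda>i. \<Sum>j=1..Suc CARD('n). poly (lagrange CARD('n) j) (d i) * \<phi> ((*\<^sub>R) (real j) ` K))
    \<longlonglongrightarrow> (\<Sum>j=1..Suc CARD('n). poly (lagrange CARD('n) j) c * \<phi> ((*\<^sub>R) (real j) ` K))"
    by (intro tendsto_sum tendsto_mult tendsto_const tendsto_poly \<open>d \<longlonglongrightarrow> c\<close>)
  ultimately show ?thesis
    using LIMSEQ_unique by (simp del: sum.cl_ivl_Suc)
qed

text \<open>Translating a point \<open>v\<close> of \<open>K\<close> to the origin changes the
  dilate by \<open>t\<close> only by the translation \<open>t v\<close>.\<close>

lemma lagrange_dilate:
  assumes "compact K" "convex K" "c > 0"
  shows "\<phi> ((*\<^sub>R) c ` K) =
    (\<Sum>j=1..Suc CARD('n). poly (lagrange CARD('n) j) c * \<phi> ((*\<^sub>R) (real j) ` K))"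
proof (cases "K = {}")
  case True
  then show ?thesis
    by (simp add: empty)
next
  case False
  then obtain v where "v \<in> K"
    by blast
  define K' where "K' = (+) (- v) ` K"
  have K': "compact K'" "convex K'" "0 \<in> K'"
    unfolding K'_def using assms \<open>v \<in> K\<close> by (auto intro: compact_translation_subtract)
  have "(*\<^sub>R) t ` K = (+) (t *\<^sub>R v) ` (*\<^sub>R) t ` K'" for t
    unfolding K'_def by (simp add: image_image scaleR_diff_right)
  then have "\<phi> ((*\<^sub>R) t ` K) = \<phi> ((*\<^sub>R) t ` K')" for t
    using K' by (simp add: translate compact_scaling convex_scaling)
  then show ?thesis
    using lagrange_dilate_star[OF K' assms(3)] by (simp del: sum.cl_ivl_Suc)
qed

end

section \<open>Quasi-concave functions\<close>

definition dilate :: "real \<Rightarrow> (real ^ 'n \<Rightarrow> real) \<Rightarrow> real ^ 'n \<Rightarrow> real" where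
  "dilate c f = (\<lambda>x. f (x /\<^sub>R c))"

definition cylinder :: "real \<Rightarrow> (real ^ 'n) set \<Rightarrow> real ^ 'n \<Rightarrow> real" where
  "cylinder t K = (\<lambda>x. if x \<in> K then t else 0)"

text \<open>The cap at \<open>m\<close> steps leaves finitely many levels, so that the step function
  can be built by adding one cylinder at a time.\<close>

definition truncation :: "nat \<Rightarrow> real \<Rightarrow> (real ^ 'n \<Rightarrow> real) \<Rightarrow> real ^ 'n \<Rightarrow> real" where
  "truncation m \<delta> f = (\<lambda>x. \<delta> * real (min m (nat \<lfloor>f x / \<delta>\<rfloor>)))"

lemma quasi_concaveI:
  assumes "\<And>x. f x \<ge> 0" and "\<And>t. t > 0 \<Longrightarrow> compact (superlevel t f) \<and> convex (superlevel t f)"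
  shows "f \<in> quasi_concave"
  using assms unfolding quasi_concave_def convex_body_def by blast

lemma quasi_concave_nonneg: "f \<in> quasi_concave \<Longrightarrow> f x \<ge> 0"
  unfolding quasi_concave_def by blast

lemma
  assumes "f \<in> quasi_concave" "t > 0"
  shows compact_superlevel: "compact (superlevel t f)" and convex_superlevel: "convex (superlevel t f)"
  using assms unfolding quasi_concave_def convex_body_def by auto

lemma superlevel_dilate:
  assumes "c > 0"
  shows "superlevel t (dilate c f) = (*\<^sub>R) c ` superlevel t f"
proof (intro set_eqI iffI)
  fix x assume "x \<in> superlevel t (dilate c f)"
  then have "c *\<^sub>R (x /\<^sub>R c) \<in> (*\<^sub>R) c ` superlevel t f"
    unfolding superlevel_def dilate_def by blast
  then show "x \<in> (*\<^sub>R) c ` superlevel t f"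
    using assms by simp
qed (use assms in \<open>auto simp: superlevel_def dilate_def\<close>)

lemma dilate_quasi_concave:
  assumes "f \<in> quasi_concave" "c > 0"
  shows "dilate c f \<in> quasi_concave"
proof (rule quasi_concaveI)
  show "dilate c f x \<ge> 0" for x
    unfolding dilate_def using assms(1) by (rule quasi_concave_nonneg)
qed (use assms in \<open>simp add: superlevel_dilate compact_superlevel convex_superlevel
    compact_scaling convex_scaling\<close>)

lemma dilate_dilate: "dilate b (dilate c f) = dilate (b * c) f"
  unfolding dilate_def by (simp add: mult.commute)

lemma dilate_one [simp]: "dilate 1 f = f"
  unfolding dilate_def by simp

lemma dilate_max: "dilate c (\<lambda>x. max (f x) (g x)) = (\<lambda>x. max (dilate c f x) (dilate c g x))"
  unfolding dilate_def ..

lemma dilate_min: "dilate c (\<lambda>x. min (f x) (g x)) = (\<lambda>x. min (dilate c f x) (dilate c g x))"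
  unfolding dilate_def ..

lemma dilate_cylinder:
  assumes "c > 0"
  shows "dilate c (cylinder t K) = cylinder t ((*\<^sub>R) c ` K)"
proof -
  have "x /\<^sub>R c \<in> K \<longleftrightarrow> x \<in> (*\<^sub>R) c ` K" for x
  proof
    assume "x /\<^sub>R c \<in> K"
    then have "c *\<^sub>R (x /\<^sub>R c) \<in> (*\<^sub>R) c ` K"
      by blast
    then show "x \<in> (*\<^sub>R) c ` K"
      using assms by simp
  qed (use assms in auto)
  then show ?thesis
    unfolding dilate_def cylinder_def by simp
qed

lemma cylinder_quasi_concave:
  assumes "t \<ge> 0" "compact K" "convex K"
  shows "cylinder t K \<in> quasi_concave"
proof (rule quasi_concaveI)
  show "compact (superlevel s (cylinder t K)) \<and> convex (superlevel s (cylinder t K))" if "s > 0" for s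
  proof -
    have "superlevel s (cylinder t K) = (if s \<le> t then K else {})"
      unfolding superlevel_def cylinder_def using that by auto
    then show ?thesis
      using assms by simp
  qed
qed (simp add: cylinder_def assms)

section \<open>Restriction of a valuation to multiples of indicators\<close>

lemma valuationD:
  assumes "valuation \<mu>" "f \<in> quasi_concave" "g \<in> quasi_concave"
    and "(\<lambda>x. max (f x) (g x)) \<in> quasi_concave"
  shows "\<mu> (\<lambda>x. max (f x) (g x)) + \<mu> (\<lambda>x. min (f x) (g x)) = \<mu> f + \<mu> g"
  using assms unfolding valuation_def by blast

lemma continuous_valD:
  assumes "continuous_val \<mu>" "f \<in> quasi_concave" "\<forall>i. F i \<in> quasi_concave"
    and "\<forall>x. (\<lambda>i. F i x) \<longlonglongrightarrow> f x"
    and "(\<forall>x. incseq (\<lambda>i. F i x)) \<or> (\<forall>x. decseq (\<lambda>i. F i x))"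
  shows "(\<lambda>i. \<mu> (F i)) \<longlonglongrightarrow> \<mu> f"
  using assms(1)[unfolded continuous_val_def, THEN bspec[OF _ assms(2)], THEN spec[of _ F]] assms(3-5)
  by simp

text \<open>At fixed height \<open>t\<close>, maximum and minimum of cylinders correspond to union
  and intersection. A decreasing sequence of bodies gives a decreasing sequence of functions that is
  eventually constant at each point.\<close>

lemma continuous_body_valuation_cylinder:
  fixes \<mu> :: "(real ^ 'n \<Rightarrow> real) \<Rightarrow> real"
  assumes "valuation \<mu>" "continuous_val \<mu>" "translation_invariant \<mu>" "t \<ge> 0"
  shows "continuous_body_valuation (\<lambda>K. \<mu> (cylinder t K))"
proof
  show "\<mu> (cylinder t {}) = 0"
    using assms(1) unfolding valuation_def cylinder_def by simp
next
  fix K L :: "(real ^ 'n) set"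
  assume KL: "compact K" "convex K" "compact L" "convex L" "convex (K \<union> L)"
  have max: "(\<lambda>x. max (cylinder t K x) (cylinder t L x)) = cylinder t (K \<union> L)"
    and min: "(\<lambda>x. min (cylinder t K x) (cylinder t L x)) = cylinder t (K \<inter> L)"
    unfolding cylinder_def using assms(4) by auto
  have "cylinder t K \<in> quasi_concave" "cylinder t L \<in> quasi_concave" "cylinder t (K \<union> L) \<in> quasi_concave"
    using KL assms(4) by (auto intro: cylinder_quasi_concave)
  then show "\<mu> (cylinder t (K \<union> L)) + \<mu> (cylinder t (K \<inter> L)) = \<mu> (cylinder t K) + \<mu> (cylinder t L)"
    using assms(1) unfolding valuation_def max[symmetric] min[symmetric] by blast
next
  fix K :: "(real ^ 'n) set" and a
  assume "compact K" "convex K"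
  then have "\<mu> (cylinder t K \<circ> (\<lambda>x. x + (- a))) = \<mu> (cylinder t K)"
    using assms(3,4) cylinder_quasi_concave unfolding translation_invariant_def by blast
  moreover have "cylinder t K \<circ> (\<lambda>x. x + (- a)) = cylinder t ((+) a ` K)"
    unfolding cylinder_def by (auto simp: fun_eq_iff image_iff)
  ultimately show "\<mu> (cylinder t ((+) a ` K)) = \<mu> (cylinder t K)"
    by simp
next
  fix K :: "nat \<Rightarrow> (real ^ 'n) set"
  assume K: "\<And>i. compact (K i)" "\<And>i. convex (K i)" "\<And>i. K (Suc i) \<subseteq> K i"
  have mono: "K j \<subseteq> K i" if "i \<le> j" for i j
    using lift_Suc_antimono_le[of K, OF K(3) that] .
  have "compact (\<Inter>i. K i)" "convex (\<Inter>i. K i)"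
    using K by (auto intro!: compact_Inter convex_INT)
  then have "cylinder t (\<Inter>i. K i) \<in> quasi_concave"
    using assms(4) by (intro cylinder_quasi_concave)
  moreover have "\<forall>i. cylinder t (K i) \<in> quasi_concave"
    using assms(4) K by (auto intro: cylinder_quasi_concave)
  moreover have "\<forall>x. (\<lambda>i. cylinder t (K i) x) \<longlonglongrightarrow> cylinder t (\<Inter>i. K i) x"
  proof
    fix x
    show "(\<lambda>i. cylinder t (K i) x) \<longlonglongrightarrow> cylinder t (\<Inter>i. K i) x"
    proof (cases "x \<in> (\<Inter>i. K i)")
      case True
      then show ?thesis
        by (simp add: cylinder_def)
    next
      case False
      then obtain i where "x \<notin> K i"
        by blast
      then have "\<forall>\<^sub>F j in sequentially. cylinder t (K j) x = cylinder t (\<Inter>i. K i) x"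
        using False mono unfolding cylinder_def eventually_sequentially by (intro exI[of _ i]) auto
      then show ?thesis
        by (rule tendsto_eventually)
    qed
  qed
  moreover have "(\<forall>x. incseq (\<lambda>i. cylinder t (K i) x)) \<or> (\<forall>x. decseq (\<lambda>i. cylinder t (K i) x))"
    using mono assms(4) unfolding cylinder_def decseq_def by (intro disjI2) auto
  ultimately show "(\<lambda>i. \<mu> (cylinder t (K i))) \<longlonglongrightarrow> \<mu> (cylinder t (\<Inter>i. K i))"
    by (rule continuous_valD[OF assms(2)])
qed

section \<open>Approximation by step functions\<close>

lemma le_nat_floor_divide_iff:
  assumes "\<delta> > 0" "k > 0"
  shows "k \<le> nat \<lfloor>y / \<delta>\<rfloor> \<longleftrightarrow> real k * \<delta> \<le> y"
proof -
  \<comment> \<open>Positivity of \<open>k\<close> matters: \<open>nat\<close> sends negative floors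
    to 0, so for \<open>k = 0\<close> the left side would hold even for negative
    \<open>y\<close>.\<close>
  have "k \<le> nat \<lfloor>y / \<delta>\<rfloor> \<longleftrightarrow> int k \<le> \<lfloor>y / \<delta>\<rfloor>"
    using assms(2) by linarith
  also have "\<dots> \<longleftrightarrow> real k \<le> y / \<delta>"
    by (simp add: le_floor_iff)
  also have "\<dots> \<longleftrightarrow> real k * \<delta> \<le> y"
    using assms(1) by (simp add: le_divide_eq)
  finally show ?thesis .
qed

text \<open>A positive superlevel set of the truncation is a superlevel set of \<open>f\<close> at
  the next multiple of \<delta>, or empty above the cap.\<close>

lemma truncation_quasi_concave:
  assumes "f \<in> quasi_concave" "\<delta> > 0"
  shows "truncation m \<delta> f \<in> quasi_concave"
proof (rule quasi_concaveI)
  show "compact (superlevel t (truncation m \<delta> f)) \<and> convex (superlevel t (truncation m \<delta> f))"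
    if "t > 0" for t
  proof -
    define k where "k = nat \<lceil>t / \<delta>\<rceil>"
    have "\<lceil>t / \<delta>\<rceil> > 0"
      using that assms(2) by simp
    then have "k > 0"
      unfolding k_def by simp
    have "t \<le> \<delta> * real r \<longleftrightarrow> k \<le> r" for r
    proof -
      have "t \<le> \<delta> * real r \<longleftrightarrow> t / \<delta> \<le> real r"
        using assms(2) by (simp add: divide_le_eq mult.commute)
      then show ?thesis
        unfolding k_def by (simp add: ceiling_le_iff nat_le_iff)
    qed
    then have "superlevel t (truncation m \<delta> f) = (if k \<le> m then superlevel (real k * \<delta>) f else {})"
      unfolding superlevel_def truncation_def
      using le_nat_floor_divide_iff[OF assms(2) \<open>k > 0\<close>] by auto
    then show ?thesis
      using assms \<open>k > 0\<close> by (simp add: compact_superlevel convex_superlevel)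
  qed
qed (use assms in \<open>simp add: truncation_def\<close>)

text \<open>One more level is the maximum with a cylinder. The corresponding minimum is again a
  cylinder, because \<open>truncation m \<delta> f\<close> has reached its cap
  \<open>m * \<delta>\<close> on the superlevel set in question.\<close>

lemma truncation_Suc:
  assumes "\<delta> > 0"
  shows "truncation (Suc m) \<delta> f =
    (\<lambda>x. max (truncation m \<delta> f x) (cylinder (real (Suc m) * \<delta>) (superlevel (real (Suc m) * \<delta>) f) x))"
    and "cylinder (real m * \<delta>) (superlevel (real (Suc m) * \<delta>) f) =
    (\<lambda>x. min (truncation m \<delta> f x) (cylinder (real (Suc m) * \<delta>) (superlevel (real (Suc m) * \<delta>) f) x))"
proof -
  have "truncation (Suc m) \<delta> f x =
      max (truncation m \<delta> f x) (cylinder (real (Suc m) * \<delta>) (superlevel (real (Suc m) * \<delta>) f) x) \<and>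
    cylinder (real m * \<delta>) (superlevel (real (Suc m) * \<delta>) f) x =
      min (truncation m \<delta> f x) (cylinder (real (Suc m) * \<delta>) (superlevel (real (Suc m) * \<delta>) f) x)" for x
  proof (cases "Suc m \<le> nat \<lfloor>f x / \<delta>\<rfloor>")
    case True
    then have "x \<in> superlevel (real (Suc m) * \<delta>) f"
      using le_nat_floor_divide_iff[OF assms, of "Suc m"] unfolding superlevel_def by auto
    then show ?thesis
      using True assms unfolding truncation_def cylinder_def
      by (auto simp: min_absorb1 algebra_simps max_def min_def)
  next
    case False
    then have "x \<notin> superlevel (real (Suc m) * \<delta>) f"
      using le_nat_floor_divide_iff[OF assms, of "Suc m"] unfolding superlevel_def by auto
    then show ?thesis
      using False assms unfolding truncation_def cylinder_def
      by (auto simp: min_absorb2)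
  qed
  then show "truncation (Suc m) \<delta> f =
    (\<lambda>x. max (truncation m \<delta> f x) (cylinder (real (Suc m) * \<delta>) (superlevel (real (Suc m) * \<delta>) f) x))"
    and "cylinder (real m * \<delta>) (superlevel (real (Suc m) * \<delta>) f) =
    (\<lambda>x. min (truncation m \<delta> f x) (cylinder (real (Suc m) * \<delta>) (superlevel (real (Suc m) * \<delta>) f) x))"
    by (auto simp only: fun_eq_iff)
qed

text \<open>With \<open>i * 2 ^ i\<close> levels of height \<open>1 / 2 ^ i\<close> the cap is
  \<open>i\<close>. This form lets the monotonicity and convergence of \<open>dyadic_ceiling\<close>
  carry over.\<close>

lemma dyadic_truncation_eq:
  assumes "f x \<ge> 0"
  shows "truncation (i * 2 ^ i) (1 / 2 ^ i) f x = min (real i) (- dyadic_ceiling i (- f x))"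
proof -
  have "real (nat \<lfloor>2 ^ i * f x\<rfloor>) = - of_int \<lceil>2 ^ i * (- f x)\<rceil>"
    using assms by (simp add: ceiling_minus)
  then have "real (nat \<lfloor>2 ^ i * f x\<rfloor>) / 2 ^ i = - dyadic_ceiling i (- f x)"
    unfolding dyadic_ceiling_def by simp
  moreover have "truncation (i * 2 ^ i) (1 / 2 ^ i) f x = min (real i) (real (nat \<lfloor>2 ^ i * f x\<rfloor>) / 2 ^ i)"
    unfolding truncation_def by (simp add: min_divide_distrib_right of_nat_min mult.commute)
  ultimately show ?thesis
    by simp
qed

section \<open>The Lagrange identity for quasi-concave functions\<close>

text \<open>Says that \<open>\<mu> (dilate c f)\<close> is a polynomial in \<open>c > 0\<close> of
  degree at most N, without mentioning unknown coefficients; in this form it is linear in the values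
  of \<mu> and survives limits.\<close>

definition lagrange_dilates :: "((real ^ 'n \<Rightarrow> real) \<Rightarrow> real) \<Rightarrow> (real ^ 'n \<Rightarrow> real) \<Rightarrow> bool" where
  "lagrange_dilates \<mu> f \<longleftrightarrow> (\<forall>c>0. \<mu> (dilate c f) =
    (\<Sum>j=1..Suc CARD('n). poly (lagrange CARD('n) j) c * \<mu> (dilate (real j) f)))"

lemma lagrange_dilates_cylinder:
  assumes "valuation \<mu>" "continuous_val \<mu>" "translation_invariant \<mu>"
    and "t \<ge> 0" "compact K" "convex K"
  shows "lagrange_dilates \<mu> (cylinder t K)"
  using continuous_body_valuation.lagrange_dilate[OF continuous_body_valuation_cylinder[OF assms(1-4)]
      assms(5,6)]
  unfolding lagrange_dilates_def by (simp add: dilate_cylinder del: sum.cl_ivl_Suc)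

lemma lagrange_dilates_max:
  fixes \<mu> :: "(real ^ 'n \<Rightarrow> real) \<Rightarrow> real"
  assumes "valuation \<mu>" "f \<in> quasi_concave" "g \<in> quasi_concave" "(\<lambda>x. max (f x) (g x)) \<in> quasi_concave"
    and "lagrange_dilates \<mu> f" "lagrange_dilates \<mu> g" "lagrange_dilates \<mu> (\<lambda>x. min (f x) (g x))"
  shows "lagrange_dilates \<mu> (\<lambda>x. max (f x) (g x))"
proof -
  have split: "\<mu> (dilate c (\<lambda>x. max (f x) (g x))) =
      \<mu> (dilate c f) + \<mu> (dilate c g) - \<mu> (dilate c (\<lambda>x. min (f x) (g x)))" if "c > 0" for c
    using valuationD[OF assms(1) assms(2-4)[THEN dilate_quasi_concave[OF _ that], unfolded dilate_max]]
    unfolding dilate_max dilate_min by linarith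
  show ?thesis
    unfolding lagrange_dilates_def
  proof (intro allI impI)
    fix c :: real assume "c > 0"
    let ?S = "\<lambda>h. \<Sum>j=1..Suc CARD('n). poly (lagrange CARD('n) j) c * \<mu> (dilate (real j) h)"
    have "?S (\<lambda>x. max (f x) (g x)) = ?S f + ?S g - ?S (\<lambda>x. min (f x) (g x))"
      unfolding sum.distrib[symmetric] sum_subtractf[symmetric]
      by (intro sum.cong refl) (simp add: split algebra_simps)
    also have "\<dots> = \<mu> (dilate c f) + \<mu> (dilate c g) - \<mu> (dilate c (\<lambda>x. min (f x) (g x)))"
      using assms(5-7)[unfolded lagrange_dilates_def, rule_format, OF \<open>c > 0\<close>] by (simp only:)
    finally show "\<mu> (dilate c (\<lambda>x. max (f x) (g x))) = ?S (\<lambda>x. max (f x) (g x))"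
      using split[OF \<open>c > 0\<close>] by simp
  qed
qed

text \<open>Induction over the levels: by \<open>truncation_Suc\<close> the maximum splits off a
  cylinder and leaves a cylinder as minimum, and cylinders are covered by the result on convex
  bodies.\<close>

lemma lagrange_dilates_truncation:
  assumes "valuation \<mu>" "continuous_val \<mu>" "translation_invariant \<mu>" "f \<in> quasi_concave" "\<delta> > 0"
  shows "lagrange_dilates \<mu> (truncation m \<delta> f)"
proof (induction m)
  case 0
  have "truncation 0 \<delta> f = cylinder 0 {}"
    unfolding truncation_def cylinder_def by simp
  then show ?case
    using lagrange_dilates_cylinder[OF assms(1-3), of 0 "{}"] by simp
next
  case (Suc m)
  let ?L = "superlevel (real (Suc m) * \<delta>) f"
  have L: "compact ?L" "convex ?L"
    using assms by (auto intro!: compact_superlevel convex_superlevel)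
  show ?case
    unfolding truncation_Suc(1)[OF assms(5)]
  proof (rule lagrange_dilates_max[OF assms(1)])
    show "truncation m \<delta> f \<in> quasi_concave"
      using assms by (intro truncation_quasi_concave)
    show "cylinder (real (Suc m) * \<delta>) ?L \<in> quasi_concave"
      using assms L by (intro cylinder_quasi_concave) auto
    show "(\<lambda>x. max (truncation m \<delta> f x) (cylinder (real (Suc m) * \<delta>) ?L x)) \<in> quasi_concave"
      unfolding truncation_Suc(1)[OF assms(5), symmetric] using assms by (intro truncation_quasi_concave)
    show "lagrange_dilates \<mu> (truncation m \<delta> f)"
      by (rule Suc.IH)
    show "lagrange_dilates \<mu> (cylinder (real (Suc m) * \<delta>) ?L)"
      using assms L by (intro lagrange_dilates_cylinder) auto
    show "lagrange_dilates \<mu> (\<lambda>x. min (truncation m \<delta> f x) (cylinder (real (Suc m) * \<delta>) ?L x))"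
      unfolding truncation_Suc(2)[OF assms(5), symmetric]
      using assms L by (intro lagrange_dilates_cylinder) auto
  qed
qed

text \<open>The dyadic truncations increase pointwise to \<open>f\<close>, and so do their dilates;
  continuity of \<mu> carries the identity to the limit.\<close>

lemma lagrange_dilates_quasi_concave:
  fixes \<mu> :: "(real ^ 'n \<Rightarrow> real) \<Rightarrow> real"
  assumes "valuation \<mu>" "continuous_val \<mu>" "translation_invariant \<mu>" "f \<in> quasi_concave"
  shows "lagrange_dilates \<mu> f"
proof -
  define F where "F i = truncation (i * 2 ^ i) (1 / 2 ^ i) f" for i
  have F_eq: "F i x = min (real i) (- dyadic_ceiling i (- f x))" for i x
    unfolding F_def using quasi_concave_nonneg[OF assms(4)] by (rule dyadic_truncation_eq)
  have F_incseq: "incseq (\<lambda>i. F i x)" for x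
    unfolding F_eq using dyadic_ceiling_Suc_le[of _ "- f x"]
    by (intro incseq_SucI min.mono) auto
  have F_lim: "(\<lambda>i. F i x) \<longlonglongrightarrow> f x" for x
  proof (rule Lim_transform_eventually)
    show "(\<lambda>i. - dyadic_ceiling i (- f x)) \<longlonglongrightarrow> f x"
      using tendsto_minus[OF dyadic_ceiling_tendsto[of "- f x"]] by simp
    \<comment> \<open>Once \<open>i\<close> exceeds \<open>f x\<close>, the cap is inactive at
      \<open>x\<close>.\<close>
    have "- dyadic_ceiling i (- f x) = F i x" if "i \<ge> nat \<lceil>f x\<rceil>" for i
    proof -
      have "- dyadic_ceiling i (- f x) \<le> f x"
        using dyadic_ceiling_ge[of "- f x" i] by simp
      also have "f x \<le> real i"
        using that by linarith
      finally show ?thesis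
        unfolding F_eq by simp
    qed
    then show "\<forall>\<^sub>F i in sequentially. - dyadic_ceiling i (- f x) = F i x"
      unfolding eventually_sequentially by blast
  qed
  have lim: "(\<lambda>i. \<mu> (dilate c (F i))) \<longlonglongrightarrow> \<mu> (dilate c f)" if "c > 0" for c
  proof -
    have "dilate c f \<in> quasi_concave" "\<forall>i. dilate c (F i) \<in> quasi_concave"
      using that assms(4) unfolding F_def by (auto intro!: dilate_quasi_concave truncation_quasi_concave)
    moreover have "\<forall>x. (\<lambda>i. dilate c (F i) x) \<longlonglongrightarrow> dilate c f x"
      "(\<forall>x. incseq (\<lambda>i. dilate c (F i) x)) \<or> (\<forall>x. decseq (\<lambda>i. dilate c (F i) x))"
      unfolding dilate_def using F_lim F_incseq by (intro allI disjI1; blast)+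
    ultimately show ?thesis
      by (rule continuous_valD[OF assms(2)])
  qed
  show ?thesis
    unfolding lagrange_dilates_def
  proof (intro allI impI)
    fix c :: real assume "c > 0"
    have "0 < (1 / 2 ^ i :: real)" for i
      by simp
    then have "\<mu> (dilate c (F i)) =
        (\<Sum>j=1..Suc CARD('n). poly (lagrange CARD('n) j) c * \<mu> (dilate (real j) (F i)))" for i
      using lagrange_dilates_truncation[OF assms] \<open>c > 0\<close>
      unfolding F_def lagrange_dilates_def by blast
    moreover have "(\<lambda>i. \<Sum>j=1..Suc CARD('n). poly (lagrange CARD('n) j) c * \<mu> (dilate (real j) (F i)))
      \<longlonglongrightarrow> (\<Sum>j=1..Suc CARD('n). poly (lagrange CARD('n) j) c * \<mu> (dilate (real j) f))"
      by (intro tendsto_sum tendsto_mult tendsto_const lim) simp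
    ultimately have "(\<lambda>i. \<mu> (dilate c (F i)))
      \<longlonglongrightarrow> (\<Sum>j=1..Suc CARD('n). poly (lagrange CARD('n) j) c * \<mu> (dilate (real j) f))"
      by (simp only:)
    then show "\<mu> (dilate c f) =
        (\<Sum>j=1..Suc CARD('n). poly (lagrange CARD('n) j) c * \<mu> (dilate (real j) f))"
      by (rule LIMSEQ_unique[OF lim[OF \<open>c > 0\<close>]])
  qed
qed

section \<open>The homogeneous components\<close>

text \<open>The coefficient of \<open>c ^ k\<close> in the Lagrange expression for
  \<open>\<mu> (dilate c f)\<close>. As a fixed linear combination of the functionals
  \<open>\<mu> (dilate (real j) f)\<close>, it inherits the properties of \<mu>.\<close>

definition homogeneous_part :: "((real ^ 'n \<Rightarrow> real) \<Rightarrow> real) \<Rightarrow> nat \<Rightarrow> (real ^ 'n \<Rightarrow> real) \<Rightarrow> real" where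
  "homogeneous_part \<mu> k f =
    (\<Sum>j=1..Suc CARD('n). coeff (lagrange CARD('n) j) k * \<mu> (dilate (real j) f))"

lemma valuation_homogeneous_part:
  fixes \<mu> :: "(real ^ 'n \<Rightarrow> real) \<Rightarrow> real"
  assumes "valuation \<mu>"
  shows "valuation (homogeneous_part \<mu> k)"
  unfolding valuation_def
proof (intro conjI ballI impI)
  have "\<mu> (dilate c (\<lambda>x. 0)) = 0" for c
    using assms unfolding valuation_def dilate_def by simp
  then show "homogeneous_part \<mu> k (\<lambda>x. 0) = 0"
    unfolding homogeneous_part_def by simp
next
  fix f g :: "real ^ 'n \<Rightarrow> real"
  assume fg: "f \<in> quasi_concave" "g \<in> quasi_concave" "(\<lambda>x. max (f x) (g x)) \<in> quasi_concave"
  have "\<mu> (dilate c (\<lambda>x. max (f x) (g x))) + \<mu> (dilate c (\<lambda>x. min (f x) (g x))) =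
      \<mu> (dilate c f) + \<mu> (dilate c g)" if "c > 0" for c
    using valuationD[OF assms fg[THEN dilate_quasi_concave[OF _ that], unfolded dilate_max]]
    unfolding dilate_max dilate_min .
  then show "homogeneous_part \<mu> k (\<lambda>x. max (f x) (g x)) + homogeneous_part \<mu> k (\<lambda>x. min (f x) (g x)) =
      homogeneous_part \<mu> k f + homogeneous_part \<mu> k g"
    unfolding homogeneous_part_def sum.distrib[symmetric] distrib_left[symmetric]
    by (intro sum.cong) auto
qed

lemma continuous_homogeneous_part:
  fixes \<mu> :: "(real ^ 'n \<Rightarrow> real) \<Rightarrow> real"
  assumes "continuous_val \<mu>"
  shows "continuous_val (homogeneous_part \<mu> k)"
  unfolding continuous_val_def
proof (intro ballI allI impI)
  fix f :: "real ^ 'n \<Rightarrow> real" and F :: "nat \<Rightarrow> real ^ 'n \<Rightarrow> real"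
  assume f: "f \<in> quasi_concave" and F: "\<forall>i. F i \<in> quasi_concave" "\<forall>x. (\<lambda>i. F i x) \<longlonglongrightarrow> f x"
    "(\<forall>x. incseq (\<lambda>i. F i x)) \<or> (\<forall>x. decseq (\<lambda>i. F i x))"
  have "(\<lambda>i. \<mu> (dilate c (F i))) \<longlonglongrightarrow> \<mu> (dilate c f)" if "c > 0" for c
  proof -
    have "\<forall>i. dilate c (F i) \<in> quasi_concave"
      using F(1) that by (simp add: dilate_quasi_concave)
    moreover have "\<forall>x. (\<lambda>i. dilate c (F i) x) \<longlonglongrightarrow> dilate c f x"
      "(\<forall>x. incseq (\<lambda>i. dilate c (F i) x)) \<or> (\<forall>x. decseq (\<lambda>i. dilate c (F i) x))"
      unfolding dilate_def using F(2,3) by auto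
    ultimately show ?thesis
      by (rule continuous_valD[OF assms dilate_quasi_concave[OF f that]])
  qed
  then show "(\<lambda>i. homogeneous_part \<mu> k (F i)) \<longlonglongrightarrow> homogeneous_part \<mu> k f"
    unfolding homogeneous_part_def by (intro tendsto_sum tendsto_mult tendsto_const) simp
qed

lemma translation_invariant_homogeneous_part:
  fixes \<mu> :: "(real ^ 'n \<Rightarrow> real) \<Rightarrow> real"
  assumes "translation_invariant \<mu>"
  shows "translation_invariant (homogeneous_part \<mu> k)"
  unfolding translation_invariant_def
proof (intro ballI allI)
  fix f :: "real ^ 'n \<Rightarrow> real" and a
  assume "f \<in> quasi_concave"
  have "\<mu> (dilate c (f \<circ> (\<lambda>x. x + a))) = \<mu> (dilate c f)" if "c > 0" for c
  proof -
    have "dilate c (f \<circ> (\<lambda>x. x + a)) = dilate c f \<circ> (\<lambda>x. x + c *\<^sub>R a)"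
      using that by (simp add: dilate_def fun_eq_iff scaleR_add_right)
    then show ?thesis
      using assms dilate_quasi_concave[OF \<open>f \<in> quasi_concave\<close> that]
      unfolding translation_invariant_def by simp
  qed
  then show "homogeneous_part \<mu> k (f \<circ> (\<lambda>x. x + a)) = homogeneous_part \<mu> k f"
    unfolding homogeneous_part_def by (intro sum.cong) auto
qed

text \<open>Expand the Lagrange polynomials and exchange the sums. The case \<open>c = 1\<close> is
  the decomposition itself.\<close>

lemma dilate_eq_sum_homogeneous_part:
  fixes \<mu> :: "(real ^ 'n \<Rightarrow> real) \<Rightarrow> real"
  assumes "valuation \<mu>" "continuous_val \<mu>" "translation_invariant \<mu>" "f \<in> quasi_concave" "c > 0"
  shows "\<mu> (dilate c f) = (\<Sum>k=0..CARD('n). c ^ k * homogeneous_part \<mu> k f)"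
proof -
  have poly: "poly (lagrange CARD('n) j) c = (\<Sum>k=0..CARD('n). coeff (lagrange CARD('n) j) k * c ^ k)"
    if "j \<in> {1..Suc CARD('n)}" for j
    using degree_lagrange[OF that] unfolding poly_altdef atMost_atLeast0
    by (intro sum.mono_neutral_left) (auto simp: coeff_eq_0)
  have "\<mu> (dilate c f) =
      (\<Sum>j=1..Suc CARD('n). poly (lagrange CARD('n) j) c * \<mu> (dilate (real j) f))"
    using lagrange_dilates_quasi_concave[OF assms(1-4)] assms(5) unfolding lagrange_dilates_def by blast
  also have "\<dots> = (\<Sum>j=1..Suc CARD('n). \<Sum>k=0..CARD('n).
      c ^ k * (coeff (lagrange CARD('n) j) k * \<mu> (dilate (real j) f)))"
    by (intro sum.cong refl) (simp only: poly sum_distrib_right, simp only: mult_ac)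
  also have "\<dots> = (\<Sum>k=0..CARD('n). c ^ k * homogeneous_part \<mu> k f)"
    unfolding homogeneous_part_def sum_distrib_left by (rule sum.swap)
  finally show ?thesis .
qed

text \<open>Expand \<mu> at the dilate of \<open>f\<close> by \<open>x * c\<close> in two ways, as a
  dilate of \<open>dilate c f\<close> and of \<open>f\<close>, and compare the coefficients of
  \<open>x ^ k\<close>.\<close>

lemma homogeneous_homogeneous_part:
  fixes \<mu> :: "(real ^ 'n \<Rightarrow> real) \<Rightarrow> real"
  assumes "valuation \<mu>" "continuous_val \<mu>" "translation_invariant \<mu>" "k \<le> CARD('n)"
  shows "homogeneous k (homogeneous_part \<mu> k)"
  unfolding homogeneous_def
proof (intro ballI allI impI)
  fix f :: "real ^ 'n \<Rightarrow> real" and c :: real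
  assume f: "f \<in> quasi_concave" and "c > 0"
  have "(\<Sum>k=0..CARD('n). x ^ k * homogeneous_part \<mu> k (dilate c f)) =
      (\<Sum>k=0..CARD('n). x ^ k * (c ^ k * homogeneous_part \<mu> k f))" if "x > 0" for x
    using dilate_eq_sum_homogeneous_part[OF assms(1-3) dilate_quasi_concave[OF f \<open>c > 0\<close>] that]
      dilate_eq_sum_homogeneous_part[OF assms(1-3) f, of "x * c"] that \<open>c > 0\<close>
    by (simp add: dilate_dilate power_mult_distrib mult.assoc)
  then have "homogeneous_part \<mu> k (dilate c f) = c ^ k * homogeneous_part \<mu> k f"
    using assms(4) by (rule power_sum_coeffs_unique)
  then show "homogeneous_part \<mu> k (\<lambda>x. f (x /\<^sub>R c)) = c ^ k * homogeneous_part \<mu> k f"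
    unfolding dilate_def .
qed

lemma homogeneous_decomposition_homogeneous_part:
  assumes "valuation \<mu>" "continuous_val \<mu>" "translation_invariant \<mu>"
  shows "homogeneous_decomposition \<mu> (homogeneous_part \<mu>)"
  unfolding homogeneous_decomposition_def
  using dilate_eq_sum_homogeneous_part[OF assms _ zero_less_one] assms
  by (simp add: valuation_homogeneous_part continuous_homogeneous_part
      translation_invariant_homogeneous_part homogeneous_homogeneous_part)

text \<open>Any decomposition exhibits its components as the coefficients of a polynomial in
  \<open>c\<close> that depends only on \<mu> and \<open>f\<close>, which forces uniqueness.\<close>

lemma dilate_eq_sum_homogeneous_decomposition:
  fixes \<mu> :: "(real ^ 'n \<Rightarrow> real) \<Rightarrow> real"
  assumes "homogeneous_decomposition \<mu> \<nu>" "f \<in> quasi_concave" "c > 0"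
  shows "\<mu> (dilate c f) = (\<Sum>k=0..CARD('n). c ^ k * \<nu> k f)"
proof -
  have "\<mu> (dilate c f) = (\<Sum>k=0..CARD('n). \<nu> k (dilate c f))"
    using assms dilate_quasi_concave unfolding homogeneous_decomposition_def by blast
  also have "\<dots> = (\<Sum>k=0..CARD('n). c ^ k * \<nu> k f)"
    using assms unfolding homogeneous_decomposition_def homogeneous_def dilate_def
    by (intro sum.cong) auto
  finally show ?thesis .
qed

theorem theorem1p1:
  fixes \<mu> :: "(real ^ 'n \<Rightarrow> real) \<Rightarrow> real"
  assumes "valuation \<mu>" and "continuous_val \<mu>" and "translation_invariant \<mu>"
  shows "(\<exists>\<nu>. homogeneous_decomposition \<mu> \<nu>) \<and>
    (\<forall>\<nu> \<nu>'. homogeneous_decomposition \<mu> \<nu> \<longrightarrow> homogeneous_decomposition \<mu> \<nu>' \<longrightarrow>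
       (\<forall>k\<le>CARD('n). \<forall>f\<in>quasi_concave. \<nu> k f = \<nu>' k f))"
proof (intro conjI allI impI ballI)
  show "\<exists>\<nu>. homogeneous_decomposition \<mu> \<nu>"
    using homogeneous_decomposition_homogeneous_part[OF assms] by blast
next
  fix \<nu> \<nu>' :: "nat \<Rightarrow> (real ^ 'n \<Rightarrow> real) \<Rightarrow> real" and k and f :: "real ^ 'n \<Rightarrow> real"
  assume "homogeneous_decomposition \<mu> \<nu>" "homogeneous_decomposition \<mu> \<nu>'"
    and k: "k \<le> CARD('n)" and "f \<in> quasi_concave"
  then have "(\<Sum>k=0..CARD('n). c ^ k * \<nu> k f) = (\<Sum>k=0..CARD('n). c ^ k * \<nu>' k f)" if "c > 0" for c
    using dilate_eq_sum_homogeneous_decomposition that by metis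
  then show "\<nu> k f = \<nu>' k f"
    using k by (rule power_sum_coeffs_unique)
qed

end
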